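(* Let $d\in\mathbb{N}$, let $\boldsymbol{\gamma}=(\gamma_u)_u$ be a collection of non-negative weights, and let $n$ be an odd prime. Then the mean squared worst-case error $\overline{e}^2(n)$ of unshifted rank-1 lattice rules in the space $H_{d,\boldsymbol{\gamma}}$ satisfies $$\overline{e}^2(n)\leq \frac{\log n}{\sqrt{n}}\sum_{\emptyset\neq u\subseteq\{1,\ldots,d\}}\gamma_u C_u,$$ where $$C_u:=\frac{2}{3^{|u|}}+\frac{1}{4^{|u|}}+4\left(\frac{23}{24}\right)^{|u|}+\left(\frac{3}{\pi^2}+\frac{5}{6}\right)^{|u|}.$$
   Context: Here $\log$ is the natural logarithm. The weights $\gamma_u\ge 0$ are indexed by subsets $u\subset\mathbb{N}$. The weighted unanchored Sobolev space $H_{d,\boldsymbol{\gamma}}$ of smoothness $1$ is the reproducing kernel Hilbert space of real-valued functions on $[0,1)^d$ with reproducing kernel $$K_{d,\boldsymbol{\gamma}}(\boldsymbol{x},\boldsymbol{y})=\sum_{u\subseteq\{1,\ldots,d\}}\gamma_u\prod_{j\in u}\eta(x_j,y_j),\qquad \eta(x,y)=\tfrac12 B_2(|x-y|)+B_1(x)B_1(y),$$ where $B_1(x)=x-\tfrac12$ and $B_2(x)=x^2-x+\tfrac16$ are the Bernoulli polynomials of degrees 1 and 2 (the empty product is $1$). Its norm is denoted $\|\cdot\|_{d,\boldsymbol{\gamma}}$. For $f:[0,1)^d\to\mathbb{R}$ integrable, let $I_d(f)=\int_{[0,1)^d}f(\boldsymbol{x})\,d\boldsymbol{x}$. For $\boldsymbol{z}=(z_1,\ldots,z_d)\in\{1,\ldots,n-1\}^d$,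 the (unshifted) rank-1 lattice rule is $$Q_{d,n,\boldsymbol{z}}(f)=\frac1n\sum_{i=0}^{n-1}f(\boldsymbol{x}_i),\qquad \boldsymbol{x}_i=\left(\left\{\frac{iz_1}{n}\right\},\ldots,\left\{\frac{iz_d}{n}\right\}\right),$$ where $\{x\}=x-\lfloor x\rfloor$. The worst-case error is $$e(n,\boldsymbol{z}):=\sup_{f\in H_{d,\boldsymbol{\gamma}},\ \|f\|_{d,\boldsymbol{\gamma}}\le 1}\left|I_d(f)-Q_{d,n,\boldsymbol{z}}(f)\right|,$$ $e^2(n,\boldsymbol{z})$ denotes its square, and the mean squared worst-case error is $$\overline{e}^2(n):=\frac{1}{(n-1)^d}\sum_{\boldsymbol{z}\in\{1,\ldots,n-1\}^d}e^2(n,\boldsymbol{z}).$$ *)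

theory Defs
  imports
    "HOL-Analysis.Analysis"
    "HOL-Computational_Algebra.Primes"
begin

(* Points of [0,1)^d are functions on {1..d}, made total by "undefined" elsewhere. *)

definition unit_cube :: "nat \<Rightarrow> (nat \<Rightarrow> real) set" where
  "unit_cube d = PiE {1..d} (\<lambda>_. {0..<1})"

definition bernoulli1 :: "real \<Rightarrow> real" where
  "bernoulli1 x = x - 1 / 2"

definition bernoulli2 :: "real \<Rightarrow> real" where
  "bernoulli2 x = x\<^sup>2 - x + 1 / 6"

definition eta :: "real \<Rightarrow> real \<Rightarrow> real" where
  "eta x y = bernoulli2 \<bar>x - y\<bar> / 2 + bernoulli1 x * bernoulli1 y"

definition sobolev_kernel ::
  "nat \<Rightarrow> (nat set \<Rightarrow> real) \<Rightarrow> (nat \<Rightarrow> real) \<Rightarrow> (nat \<Rightarrow> real) \<Rightarrow> real" where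
  "sobolev_kernel d \<gamma> x y = (\<Sum>u\<in>Pow {1..d}. \<gamma> u * (\<Prod>j\<in>u. eta (x j) (y j)))"

definition ip_norm :: "(('a \<Rightarrow> real) \<Rightarrow> ('a \<Rightarrow> real) \<Rightarrow> real) \<Rightarrow> ('a \<Rightarrow> real) \<Rightarrow> real" where
  "ip_norm ip f = sqrt (ip f f)"

(* A real-valued function on X is represented by its extension by 0 outside X, so that
   pointwise operations and equality of functions on X are those of the function type.
   The inner product is unconstrained outside H. By the Moore-Aronszajn theorem, a positive
   semidefinite kernel on X has exactly one such H, and ip is unique on H. *)

locale rkhs =
  fixes X :: "'a set"
    and K :: "'a \<Rightarrow> 'a \<Rightarrow> real"
    and H :: "('a \<Rightarrow> real) set"
    and ip :: "('a \<Rightarrow> real) \<Rightarrow> ('a \<Rightarrow> real) \<Rightarrow> real"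
  assumes vanishes_outside: "f \<in> H \<Longrightarrow> x \<notin> X \<Longrightarrow> f x = 0"
    and zero_closed: "(\<lambda>_. 0) \<in> H"
    and add_closed: "f \<in> H \<Longrightarrow> g \<in> H \<Longrightarrow> (\<lambda>x. f x + g x) \<in> H"
    and scale_closed: "f \<in> H \<Longrightarrow> (\<lambda>x. c * f x) \<in> H"
    and ip_commute: "f \<in> H \<Longrightarrow> g \<in> H \<Longrightarrow> ip f g = ip g f"
    and ip_add_left: "f \<in> H \<Longrightarrow> g \<in> H \<Longrightarrow> h \<in> H \<Longrightarrow> ip (\<lambda>x. f x + g x) h = ip f h + ip g h"
    and ip_scale_left: "f \<in> H \<Longrightarrow> g \<in> H \<Longrightarrow> ip (\<lambda>x. c * f x) g = c * ip f g"
    and ip_ge_zero: "f \<in> H \<Longrightarrow> 0 \<le> ip f f"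
    and ip_definite: "f \<in> H \<Longrightarrow> ip f f = 0 \<Longrightarrow> f = (\<lambda>_. 0)"
    and complete: "(\<And>k. F k \<in> H) \<Longrightarrow>
        (\<And>e. 0 < e \<Longrightarrow> \<exists>N. \<forall>k\<ge>N. \<forall>l\<ge>N. ip_norm ip (\<lambda>x. F k x - F l x) < e) \<Longrightarrow>
        \<exists>f\<in>H. (\<lambda>k::nat. ip_norm ip (\<lambda>x. F k x - f x)) \<longlonglongrightarrow> 0"
    and kernel_closed: "y \<in> X \<Longrightarrow> (\<lambda>x. if x \<in> X then K x y else 0) \<in> H"
    and reproducing: "f \<in> H \<Longrightarrow> y \<in> X \<Longrightarrow> ip f (\<lambda>x. if x \<in> X then K x y else 0) = f y"

definition cube_integral :: "nat \<Rightarrow> ((nat \<Rightarrow> real) \<Rightarrow> real) \<Rightarrow> real" where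
  "cube_integral d f = (LINT x:unit_cube d|PiM {1..d} (\<lambda>_. lborel). f x)"

definition lattice_point :: "nat \<Rightarrow> nat \<Rightarrow> (nat \<Rightarrow> nat) \<Rightarrow> nat \<Rightarrow> nat \<Rightarrow> real" where
  "lattice_point d n z i = (\<lambda>j\<in>{1..d}. frac (real i * real (z j) / real n))"

definition lattice_rule :: "nat \<Rightarrow> nat \<Rightarrow> (nat \<Rightarrow> nat) \<Rightarrow> ((nat \<Rightarrow> real) \<Rightarrow> real) \<Rightarrow> real" where
  "lattice_rule d n z f = (\<Sum>i<n. f (lattice_point d n z i)) / real n"

(* The supremum is a real one. For the kernel sobolev_kernel d \<gamma> it is taken over a bounded
   set of errors of integrable functions: every f in H is continuous on the cube, with
   \<bar>f x\<bar> \<le> ip_norm ip f * sqrt (K x x) and K bounded. *)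

definition worst_case_error ::
  "((nat \<Rightarrow> real) \<Rightarrow> real) set \<Rightarrow> (((nat \<Rightarrow> real) \<Rightarrow> real) \<Rightarrow> ((nat \<Rightarrow> real) \<Rightarrow> real) \<Rightarrow> real) \<Rightarrow>
    nat \<Rightarrow> nat \<Rightarrow> (nat \<Rightarrow> nat) \<Rightarrow> real" where
  "worst_case_error H ip d n z =
    (SUP f\<in>{f \<in> H. ip_norm ip f \<le> 1}. \<bar>cube_integral d f - lattice_rule d n z f\<bar>)"

definition mean_squared_worst_case_error ::
  "((nat \<Rightarrow> real) \<Rightarrow> real) set \<Rightarrow> (((nat \<Rightarrow> real) \<Rightarrow> real) \<Rightarrow> ((nat \<Rightarrow> real) \<Rightarrow> real) \<Rightarrow> real) \<Rightarrow>
    nat \<Rightarrow> nat \<Rightarrow> real" where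
  "mean_squared_worst_case_error H ip d n =
    (\<Sum>z\<in>PiE {1..d} (\<lambda>_. {1..n - 1}). (worst_case_error H ip d n z)\<^sup>2) / (real n - 1) ^ d"

definition C_const :: "nat set \<Rightarrow> real" where
  "C_const u = 2 / 3 ^ card u + 1 / 4 ^ card u + 4 * (23 / 24) ^ card u
    + (3 / pi\<^sup>2 + 5 / 6) ^ card u"

end

theory Submission imports Defs begin

text \<open>
  In a reproducing kernel Hilbert space a finite combination of point evaluations has a norm given
  by a double sum of kernel values. The integral of \<open>f\<close> over the cube is the limit of averages of
  \<open>f\<close> over uniform grids, so the error of the lattice rule is a limit of such combinations
  (\<open>quadrature_error_bound\<close>). Since \<open>eta x y\<close> has integral \<open>0\<close> in \<open>x\<close>, its grid averages vanish in
  the limit, and of all kernel terms only those between two lattice points survive: the squared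
  worst-case error is at most the mean of the kernel over pairs of lattice points, minus
  \<open>\<gamma> {}\<close>.

  The mean over the generating vector \<open>z\<close> factorises over the coordinates. The set \<open>u\<close> then
  contributes \<open>\<gamma> u\<close> times the mean over \<open>i, k < n\<close> of \<open>A i k ^ card u\<close>, where \<open>A i k\<close> is the mean
  of \<open>eta\<close> at the fractional parts of \<open>i z / n\<close> and \<open>k z / n\<close> over the residues \<open>z \<noteq> 0\<close>. As
  \<open>\<bar>A i k\<bar> \<le> 1/3\<close>, it suffices to bound the mean of \<open>\<bar>A i k\<bar>\<close>, at the price of a factor
  \<open>3 * (1/3) ^ card u\<close>.

  For distinct nonzero \<open>i\<close> and \<open>k\<close> the number \<open>A i k\<close> is, up to \<open>O(1/n)\<close>, a Dedekind sum divided by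
  \<open>n - 1\<close>: a correlation of two dilates of the sawtooth function modulo \<open>n\<close>. By the discrete Fourier
  transform \<open>F\<close> of the sawtooth function, such a correlation is \<open>1/n\<close> times the sum of
  \<open>F m * F l\<close> over all \<open>m, l\<close> with \<open>m i + l k\<close> divisible by \<open>n\<close>. Individual correlations can be as
  large as a multiple of \<open>n\<close>, but the sum of their absolute values over \<open>k\<close> is small: \<open>F 0\<close> vanishes,
  and for given \<open>m\<close> and \<open>l \<noteq> 0\<close> at most one \<open>k\<close> satisfies the congruence, so the sum is at most
  \<open>(\<Sum>m. \<bar>F m\<bar>)\<^sup>2 / n\<close>. Since \<open>\<bar>F m\<bar> \<le> n / (4 m)\<close> for \<open>0 < m < n/2\<close>, and likewise for \<open>n - m\<close>, this is at
  most \<open>n / 4 * (ln n)\<^sup>2\<close> (\<open>sum_abs_sawtooth_correlation_le\<close>).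

  Hence the mean of \<open>\<bar>A i k\<bar>\<close> is at most of order \<open>(ln n)\<^sup>2 / n\<close>, which is below a multiple of
  \<open>ln n / sqrt n\<close>. The multiple is small enough for the single term \<open>4 * (23/24) ^ card u\<close> of
  \<open>C_const u\<close> to absorb it.
\<close>

section \<open>Finite sums and residues\<close>

lemma sum_of_nat_lessThan: "(\<Sum>k<N. real k) = real N * (real N - 1) / 2"
  by (induction N) (simp_all add: field_simps)

lemma sum_of_nat_squares_lessThan:
  "(\<Sum>k<N. (real k)\<^sup>2) = real N * (real N - 1) * (2 * real N - 1) / 6"
  by (induction N) (simp_all add: field_simps power2_eq_square)

lemma sum_rotate:
  "(\<Sum>z\<in>A. \<Sum>m\<in>B. \<Sum>l\<in>C. f z m l) = (\<Sum>m\<in>B. \<Sum>l\<in>C. \<Sum>z\<in>A. f z m l)"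
  by (subst sum.swap, intro sum.cong refl sum.swap)

text \<open>Averages over a product set factorise; coordinates outside \<open>u\<close> average the constant \<open>1\<close>. This
  serves both for grids of points and for the mean over generating vectors.\<close>
lemma sum_PiE_prod_subset:
  fixes h :: "'i \<Rightarrow> 'a \<Rightarrow> real"
  assumes "finite D" "u \<subseteq> D" "finite S" "S \<noteq> {}"
  shows "(\<Sum>k\<in>PiE D (\<lambda>_. S). \<Prod>j\<in>u. h j (k j)) / real (card S) ^ card D
    = (\<Prod>j\<in>u. (\<Sum>y\<in>S. h j y) / real (card S))"
proof -
  let ?h = "\<lambda>j y. if j \<in> u then h j y else 1"
  have "(\<Sum>k\<in>PiE D (\<lambda>_. S). \<Prod>j\<in>u. h j (k j)) = (\<Sum>k\<in>PiE D (\<lambda>_. S). \<Prod>j\<in>D. ?h j (k j))"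
  proof (rule sum.cong[OF refl])
    fix k
    show "(\<Prod>j\<in>u. h j (k j)) = (\<Prod>j\<in>D. ?h j (k j))"
      using assms by (simp add: prod.If_cases Int_absorb1 inf.absorb2)
  qed
  also have "\<dots> = (\<Prod>j\<in>D. \<Sum>y\<in>S. ?h j y)"
    using assms by (simp add: prod_sum_PiE)
  also have "\<dots> / real (card S) ^ card D = (\<Prod>j\<in>D. (\<Sum>y\<in>S. ?h j y) / real (card S))"
    by (simp add: prod_dividef)
  also have "\<dots> = (\<Prod>j\<in>D. if j \<in> u then (\<Sum>y\<in>S. h j y) / real (card S) else 1)"
    using assms by (intro prod.cong) auto
  also have "\<dots> = (\<Prod>j\<in>u. (\<Sum>y\<in>S. h j y) / real (card S))"
    using assms by (simp add: prod.If_cases Int_absorb1 inf.absorb2)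
  finally show ?thesis .
qed

lemma prime_mult_diff_cancel:
  fixes h y z n :: nat
  assumes "prime n" "\<not> n dvd h" "y < n" "z < n" and dvd: "int n dvd int h * (int y - int z)"
  shows "y = z"
proof (rule ccontr)
  assume "y \<noteq> z"
  have "prime (int n)" "\<not> int n dvd int h" using assms by simp_all
  then have "int n dvd int y - int z" using dvd prime_dvd_mult_iff by blast
  then have "\<bar>int n\<bar> \<le> \<bar>int y - int z\<bar>" using \<open>y \<noteq> z\<close> by (intro dvd_imp_le_int) auto
  then show False using assms(3,4) by linarith
qed

lemma frac_of_nat_divide: "frac (real a / real n) = real (a mod n) / real n"
proof (cases "n = 0")
  case False
  have "real a = real (a div n) * real n + real (a mod n)"
    by (metis div_mult_mod_eq of_nat_add of_nat_mult)
  with False show ?thesis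
    unfolding frac_def floor_divide_of_nat_eq by (simp add: field_simps)
qed simp

section \<open>Point evaluations in a reproducing kernel Hilbert space\<close>

lemma (in rkhs) ip_cauchy_schwarz:
  assumes f: "f \<in> H" and g: "g \<in> H"
  shows "(ip f g)\<^sup>2 \<le> ip f f * ip g g"
proof (cases "ip g g = 0")
  case True
  then have g0: "g = (\<lambda>_. 0)" using ip_definite g by blast
  have "ip (\<lambda>x. 0 * g x) f = 0 * ip g f" using ip_scale_left g f by blast
  then have "ip g f = 0" using g0 by simp
  then show ?thesis using ip_commute[OF f g] ip_ge_zero[OF f] ip_ge_zero[OF g] by simp
next
  case False
  then have pos: "ip g g > 0" using ip_ge_zero[OF g] by simp
  \<comment> \<open>The minimiser of the squared norm of \<open>f + t g\<close>.\<close>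
  define t where "t = - ip f g / ip g g"
  let ?tg = "\<lambda>x. t * g x"
  have tg: "?tg \<in> H" using scale_closed g .
  have "ip (\<lambda>x. f x + ?tg x) (\<lambda>x. f x + ?tg x) = ip f f + 2 * t * ip f g + t\<^sup>2 * ip g g"
  proof -
    let ?s = "\<lambda>x. f x + ?tg x"
    have s: "?s \<in> H" using add_closed f tg by blast
    have "ip ?s ?s = ip f ?s + t * ip g ?s"
      using ip_add_left[OF f tg s] ip_scale_left[OF g s] by simp
    moreover have "ip f ?s = ip f f + t * ip f g"
      using ip_commute[OF f s] ip_add_left[OF f tg f] ip_scale_left[OF g f] ip_commute[OF f g]
      by simp
    moreover have "ip g ?s = ip f g + t * ip g g"
      using ip_commute[OF g s] ip_add_left[OF f tg g] ip_scale_left[OF g g] by simp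
    ultimately show ?thesis by (simp add: algebra_simps power2_eq_square)
  qed
  then have "0 \<le> ip f f + 2 * t * ip f g + t\<^sup>2 * ip g g"
    using ip_ge_zero[OF add_closed[OF f tg]] by simp
  also have "\<dots> = ip f f - (ip f g)\<^sup>2 / ip g g"
    using pos by (simp add: t_def power2_eq_square field_simps)
  finally show ?thesis using pos by (simp add: field_simps)
qed

lemma (in rkhs) kernel_combination:
  fixes w :: "'i \<Rightarrow> real"
  assumes "finite S" and "\<And>a. a \<in> S \<Longrightarrow> p a \<in> X"
  defines "g \<equiv> \<lambda>x. \<Sum>a\<in>S. w a * (if x \<in> X then K x (p a) else 0)"
  shows "g \<in> H" and "f \<in> H \<Longrightarrow> ip f g = (\<Sum>a\<in>S. w a * f (p a))"
proof -
  have "g \<in> H \<and> (\<forall>f\<in>H. ip f g = (\<Sum>a\<in>S. w a * f (p a)))"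
    using assms(1,2) unfolding g_def
  proof (induction S)
    case empty
    have "ip f (\<lambda>_. 0) = 0" if f: "f \<in> H" for f
      using ip_scale_left[OF zero_closed f, of 0] ip_commute[OF f zero_closed] by simp
    then show ?case using zero_closed by simp
  next
    case (insert a S)
    let ?r = "\<lambda>x. \<Sum>a\<in>S. w a * (if x \<in> X then K x (p a) else 0)"
    let ?k = "\<lambda>x. if x \<in> X then K x (p a) else 0"
    let ?wk = "\<lambda>x. w a * ?k x"
    have r: "?r \<in> H" and ipr: "\<And>f. f \<in> H \<Longrightarrow> ip f ?r = (\<Sum>a\<in>S. w a * f (p a))"
      using insert by auto
    have k: "?k \<in> H" using kernel_closed insert.prems by simp
    have wk: "?wk \<in> H" by (rule scale_closed[OF k])
    have split: "(\<lambda>x. \<Sum>a\<in>insert a S. w a * (if x \<in> X then K x (p a) else 0))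
        = (\<lambda>x. ?wk x + ?r x)"
      using insert.hyps by simp
    have sum: "(\<lambda>x. ?wk x + ?r x) \<in> H" by (rule add_closed[OF wk r])
    have "ip f (\<lambda>x. ?wk x + ?r x) = w a * f (p a) + (\<Sum>a\<in>S. w a * f (p a))" if f: "f \<in> H" for f
      using ip_commute[OF f sum] ip_add_left[OF wk r f] ip_scale_left[OF k f]
        ip_commute[OF f k] reproducing[OF f, of "p a"] ipr[OF f] ip_commute[OF f r] insert.prems
      by simp
    then show ?case unfolding split using sum insert.hyps by simp
  qed
  then show "g \<in> H" and "f \<in> H \<Longrightarrow> ip f g = (\<Sum>a\<in>S. w a * f (p a))" by auto
qed

lemma (in rkhs) ip_kernel_combination:
  fixes w :: "'i \<Rightarrow> real"
  assumes "finite S" and "\<And>a. a \<in> S \<Longrightarrow> p a \<in> X"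
  defines "g \<equiv> \<lambda>x. \<Sum>a\<in>S. w a * (if x \<in> X then K x (p a) else 0)"
  shows "ip g g = (\<Sum>a\<in>S. \<Sum>b\<in>S. w a * w b * K (p a) (p b))"
proof -
  have "ip g g = (\<Sum>a\<in>S. w a * g (p a))"
    unfolding g_def by (intro kernel_combination) (use assms in auto)
  also have "\<dots> = (\<Sum>a\<in>S. \<Sum>b\<in>S. w a * w b * K (p a) (p b))"
    by (rule sum.cong) (use assms(2) in \<open>simp_all add: g_def sum_distrib_left mult.assoc\<close>)
  finally show ?thesis .
qed

lemma (in rkhs) kernel_form_nonneg:
  fixes w :: "'i \<Rightarrow> real"
  assumes "finite S" and "\<And>a. a \<in> S \<Longrightarrow> p a \<in> X"
  shows "0 \<le> (\<Sum>a\<in>S. \<Sum>b\<in>S. w a * w b * K (p a) (p b))"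
  using ip_ge_zero[OF kernel_combination(1)[of S p w]] ip_kernel_combination[of S p w] assms
  by simp

text \<open>The functional on the left is represented by the same combination of kernel sections, and
  the double sum is the squared norm of this representer.\<close>
lemma (in rkhs) evaluation_combination_bound:
  fixes w :: "'i \<Rightarrow> real"
  assumes "f \<in> H" and "finite S" and "\<And>a. a \<in> S \<Longrightarrow> p a \<in> X"
  shows "\<bar>\<Sum>a\<in>S. w a * f (p a)\<bar>
    \<le> ip_norm ip f * sqrt (\<Sum>a\<in>S. \<Sum>b\<in>S. w a * w b * K (p a) (p b))"
proof -
  let ?g = "\<lambda>x. \<Sum>a\<in>S. w a * (if x \<in> X then K x (p a) else 0)"
  have "?g \<in> H" and "ip f ?g = (\<Sum>a\<in>S. w a * f (p a))"
    using kernel_combination[where S = S and p = p and w = w] assms by auto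
  moreover have "ip ?g ?g = (\<Sum>a\<in>S. \<Sum>b\<in>S. w a * w b * K (p a) (p b))"
    by (rule ip_kernel_combination) (use assms in auto)
  ultimately have "(\<Sum>a\<in>S. w a * f (p a))\<^sup>2
      \<le> ip f f * (\<Sum>a\<in>S. \<Sum>b\<in>S. w a * w b * K (p a) (p b))"
    using ip_cauchy_schwarz[OF assms(1), of ?g] by simp
  then have "sqrt ((\<Sum>a\<in>S. w a * f (p a))\<^sup>2)
      \<le> sqrt (ip f f * (\<Sum>a\<in>S. \<Sum>b\<in>S. w a * w b * K (p a) (p b)))"
    by (rule real_sqrt_le_mono)
  then show ?thesis by (simp add: ip_norm_def real_sqrt_mult)
qed

section \<open>The one-dimensional kernel\<close>

text \<open>The absolute value and the two Bernoulli polynomials combine into a formula whose only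
  non-polynomial part is a maximum. Continuity, the bound by \<open>1/3\<close> and the grid averages
  are all read off from it.\<close>
lemma eta_eq_max: "eta x y = (x\<^sup>2 + y\<^sup>2) / 2 - max x y + 1 / 3"
  unfolding eta_def bernoulli1_def bernoulli2_def
  by (cases "x \<le> y") (simp_all add: max_def abs_if field_simps power2_eq_square)

lemma abs_eta_le:
  assumes "0 \<le> x" "x \<le> 1" "0 \<le> y" "y \<le> 1"
  shows "\<bar>eta x y\<bar> \<le> 1 / 3"
proof -
  have sq: "0 \<le> t\<^sup>2" "t\<^sup>2 \<le> t" if "0 \<le> t" "t \<le> 1" for t :: real
    using that by (auto simp: power2_eq_square mult_left_le)
  define M where "M = max x y"
  have "0 \<le> (1 - M)\<^sup>2" by simp
  then have "2 * M \<le> 1 + M\<^sup>2" by (simp add: power2_eq_square algebra_simps)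
  moreover have "M\<^sup>2 \<le> x\<^sup>2 + y\<^sup>2" "x\<^sup>2 + y\<^sup>2 \<le> 2 * M"
    using sq(1,2)[of x] sq(1,2)[of y] assms by (auto simp: max_def M_def)
  ultimately show ?thesis
    unfolding eta_eq_max M_def[symmetric] by (simp add: abs_le_iff field_simps)
qed

lemma eta_commute: "eta x y = eta y x"
  by (simp add: eta_eq_max add.commute max.commute)

section \<open>Integration over the cube by averaging over grids\<close>

definition grid :: "nat \<Rightarrow> nat \<Rightarrow> (nat \<Rightarrow> nat) set" where
  "grid d m = PiE {1..d} (\<lambda>_. {..<m})"

definition grid_point :: "nat \<Rightarrow> nat \<Rightarrow> (nat \<Rightarrow> nat) \<Rightarrow> nat \<Rightarrow> real" where
  "grid_point d m k = (\<lambda>j\<in>{1..d}. real (k j) / real m)"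

lemma finite_grid: "finite (grid d m)" and card_grid: "card (grid d m) = m ^ d"
  by (simp_all add: grid_def finite_PiE card_PiE)

lemma grid_point_in_unit_cube: "k \<in> grid d m \<Longrightarrow> grid_point d m k \<in> unit_cube d"
  by (fastforce simp: grid_def grid_point_def unit_cube_def PiE_iff)

definition grid_cell :: "nat \<Rightarrow> nat \<Rightarrow> (nat \<Rightarrow> nat) \<Rightarrow> (nat \<Rightarrow> real) set" where
  "grid_cell d m k = PiE {1..d} (\<lambda>j. {real (k j) / real m ..< (real (k j) + 1) / real m})"

definition grid_index :: "nat \<Rightarrow> nat \<Rightarrow> (nat \<Rightarrow> real) \<Rightarrow> nat \<Rightarrow> nat" where
  "grid_index d m x = (\<lambda>j\<in>{1..d}. nat \<lfloor>real m * x j\<rfloor>)"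

lemma grid_index_in_grid:
  assumes "m > 0" "x \<in> unit_cube d" shows "grid_index d m x \<in> grid d m"
  unfolding grid_def grid_index_def
proof (rule restrict_PiE_iff[THEN iffD2], rule ballI)
  fix j assume "j \<in> {1..d}"
  then have x: "0 \<le> x j" "x j < 1" using assms(2) by (auto simp: unit_cube_def PiE_iff)
  then have "real m * x j < real m" using assms(1) by simp
  then have "\<lfloor>real m * x j\<rfloor> < int m" by (simp add: floor_less_iff)
  then show "nat \<lfloor>real m * x j\<rfloor> \<in> {..<m}" using assms(1) by auto
qed

lemma grid_cell_iff:
  assumes m: "m > 0" and k: "k \<in> grid d m" and x: "x \<in> unit_cube d"
  shows "x \<in> grid_cell d m k \<longleftrightarrow> k = grid_index d m x"
proof -
  have xj: "0 \<le> x j" "x j < 1" if "j \<in> {1..d}" for j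
    using that x by (auto simp: unit_cube_def PiE_iff)
  have one: "x j \<in> {real (k j) / real m ..< (real (k j) + 1) / real m} \<longleftrightarrow> k j = nat \<lfloor>real m * x j\<rfloor>"
    if j: "j \<in> {1..d}" for j
  proof -
    have "0 \<le> \<lfloor>real m * x j\<rfloor>" using xj(1)[OF j] by simp
    then have "k j = nat \<lfloor>real m * x j\<rfloor> \<longleftrightarrow> \<lfloor>real m * x j\<rfloor> = int (k j)" by auto
    also have "\<dots> \<longleftrightarrow> real (k j) \<le> real m * x j \<and> real m * x j < real (k j) + 1"
      by (simp add: floor_eq_iff)
    finally show ?thesis using m by (auto simp: field_simps)
  qed
  have ext: "k \<in> extensional {1..d}" "x \<in> extensional {1..d}"
    using k x by (auto simp: grid_def unit_cube_def PiE_iff)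
  have "x \<in> grid_cell d m k \<longleftrightarrow> (\<forall>j\<in>{1..d}. k j = nat \<lfloor>real m * x j\<rfloor>)"
    using one ext(2) by (simp add: grid_cell_def PiE_iff)
  also have "\<dots> \<longleftrightarrow> k = grid_index d m x"
    using ext(1) by (auto simp: grid_index_def fun_eq_iff extensional_def)
  finally show ?thesis .
qed

lemma grid_cell_subset:
  assumes m: "m > 0" and k: "k \<in> grid d m"
  shows "grid_cell d m k \<subseteq> unit_cube d"
  unfolding grid_cell_def unit_cube_def
proof (rule PiE_mono)
  fix j assume j: "j \<in> {1..d}"
  have "k j + 1 \<le> m" using PiE_mem[OF k[unfolded grid_def] j] by simp
  then have "real (k j) + 1 \<le> real m" by linarith
  then have "(real (k j) + 1) / real m \<le> 1" using m by simp
  moreover have "0 \<le> real (k j) / real m" by simp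
  ultimately show "{real (k j) / real m ..< (real (k j) + 1) / real m} \<subseteq> {0..<1}"
    unfolding ivl_subset by blast
qed

lemma measure_grid_cell:
  assumes "m > 0"
  shows "grid_cell d m k \<in> sets (PiM {1..d} (\<lambda>_. lborel))"
    and "emeasure (PiM {1..d} (\<lambda>_. lborel)) (grid_cell d m k) = ennreal (1 / real m ^ d)"
proof -
  interpret product_sigma_finite "\<lambda>_::nat. lborel :: real measure" by standard
  show "grid_cell d m k \<in> sets (PiM {1..d} (\<lambda>_. lborel))"
    unfolding grid_cell_def by (rule sets_PiM_I_finite) auto
  have "emeasure (PiM {1..d} (\<lambda>_. lborel)) (grid_cell d m k)
      = (\<Prod>j\<in>{1..d}. emeasure lborel {real (k j) / real m ..< (real (k j) + 1) / real m})"
    unfolding grid_cell_def by (rule emeasure_PiM) auto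
  also have "\<dots> = (\<Prod>j\<in>{1..d}. ennreal (1 / real m))"
    using assms by (intro prod.cong refl) (simp add: field_simps)
  also have "\<dots> = ennreal (1 / real m ^ d)"
    by (simp add: ennreal_power power_one_over)
  finally show "emeasure (PiM {1..d} (\<lambda>_. lborel)) (grid_cell d m k) = ennreal (1 / real m ^ d)" .
qed

lemma measure_unit_cube:
  shows "unit_cube d \<in> sets (PiM {1..d} (\<lambda>_. lborel))"
    and "emeasure (PiM {1..d} (\<lambda>_. lborel)) (unit_cube d) < \<infinity>"
proof -
  have "unit_cube d = grid_cell d 1 (\<lambda>_. 0)" by (simp add: unit_cube_def grid_cell_def)
  then show "unit_cube d \<in> sets (PiM {1..d} (\<lambda>_. lborel))"
    and "emeasure (PiM {1..d} (\<lambda>_. lborel)) (unit_cube d) < \<infinity>"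
    using measure_grid_cell[of 1 d "\<lambda>_. 0"] by simp_all
qed

lemma grid_index_tendsto:
  assumes "x \<in> unit_cube d" "j \<in> {1..d}"
  shows "(\<lambda>m. grid_point d (Suc m) (grid_index d (Suc m) x) j) \<longlonglongrightarrow> x j"
proof -
  have x: "0 \<le> x j" using assms by (auto simp: unit_cube_def PiE_iff)
  have bound: "\<bar>grid_point d (Suc m) (grid_index d (Suc m) x) j - x j\<bar> \<le> 1 / real (Suc m)" for m
  proof -
    have "real (nat \<lfloor>real (Suc m) * x j\<rfloor>) = of_int \<lfloor>real (Suc m) * x j\<rfloor>" using x by simp
    then have "\<bar>real (nat \<lfloor>real (Suc m) * x j\<rfloor>) - real (Suc m) * x j\<bar> \<le> 1" by linarith
    moreover have "grid_point d (Suc m) (grid_index d (Suc m) x) j - x j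
        = (real (nat \<lfloor>real (Suc m) * x j\<rfloor>) - real (Suc m) * x j) / real (Suc m)"
      using assms(2) by (simp add: grid_point_def grid_index_def diff_divide_distrib del: of_nat_Suc)
    ultimately show ?thesis by (simp only: abs_divide abs_of_nat) (simp add: divide_right_mono)
  qed
  have "(\<lambda>m. grid_point d (Suc m) (grid_index d (Suc m) x) j - x j) \<longlonglongrightarrow> 0"
    by (rule Lim_null_comparison[OF always_eventually LIMSEQ_Suc[OF lim_1_over_n]])
      (use bound in \<open>simp del: of_nat_Suc\<close>)
  then show ?thesis by (rule LIM_zero_cancel)
qed

text \<open>The grid average is the integral of the step function that takes on each cell the value of
  \<open>f\<close> at the lower corner. These step functions converge to \<open>f\<close> by continuity, which gives
  measurability of \<open>f\<close> as well, and dominated convergence applies.\<close>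
lemma grid_averages_tendsto_cube_integral:
  fixes f :: "(nat \<Rightarrow> real) \<Rightarrow> real"
  assumes bounded: "\<And>x. x \<in> unit_cube d \<Longrightarrow> \<bar>f x\<bar> \<le> B"
    and cont: "\<And>x p. x \<in> unit_cube d \<Longrightarrow> (\<And>m. p m \<in> unit_cube d)
      \<Longrightarrow> (\<And>j. j \<in> {1..d} \<Longrightarrow> (\<lambda>m::nat. p m j) \<longlonglongrightarrow> x j) \<Longrightarrow> (\<lambda>m. f (p m)) \<longlonglongrightarrow> f x"
  shows "(\<lambda>m. (\<Sum>k\<in>grid d (Suc m). f (grid_point d (Suc m) k)) / real (Suc m) ^ d)
    \<longlonglongrightarrow> cube_integral d f"
proof -
  let ?M = "PiM {1..d} (\<lambda>_. lborel) :: (nat \<Rightarrow> real) measure"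
  let ?F = "\<lambda>x. indicator (unit_cube d) x * f x"
  define step where
    "step m x = (\<Sum>k\<in>grid d m. f (grid_point d m k) * indicator (grid_cell d m k) x)" for m x
  have step_eq: "step m x = ?F (if x \<in> unit_cube d then grid_point d m (grid_index d m x) else x)"
    if m: "m > 0" for m x
  proof (cases "x \<in> unit_cube d")
    case True
    have "step m x = (\<Sum>k\<in>grid d m. if k = grid_index d m x then f (grid_point d m k) else 0)"
      unfolding step_def by (rule sum.cong) (auto simp: grid_cell_iff[OF m _ True])
    also have "\<dots> = f (grid_point d m (grid_index d m x))"
      using grid_index_in_grid[OF m True] by (simp add: finite_grid)
    finally show ?thesis using True grid_point_in_unit_cube[OF grid_index_in_grid[OF m True]] by simp
  next
    case False
    then have "step m x = (\<Sum>k\<in>grid d m. 0)"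
      unfolding step_def using grid_cell_subset[OF m] by (intro sum.cong) (auto simp: indicator_def)
    then show ?thesis using False by simp
  qed
  have meas: "step m \<in> borel_measurable ?M" if "m > 0" for m
    unfolding step_def using measure_grid_cell(1)[OF that]
    by (intro borel_measurable_sum borel_measurable_times borel_measurable_indicator) auto
  have int: "integral\<^sup>L ?M (step m) = (\<Sum>k\<in>grid d m. f (grid_point d m k)) / real m ^ d"
    if m: "m > 0" for m
  proof -
    have "integrable ?M (\<lambda>x. f (grid_point d m k) * indicator (grid_cell d m k) x)" for k
      using measure_grid_cell[OF m] by (intro integrable_mult_right integrable_real_indicator) auto
    then have "integral\<^sup>L ?M (step m) = (\<Sum>k\<in>grid d m. f (grid_point d m k) * measure ?M (grid_cell d m k))"
      unfolding step_def using measure_grid_cell(1)[OF m] sets.sets_into_space[OF measure_grid_cell(1)[OF m]]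
      by (subst Bochner_Integration.integral_sum) (auto simp: Int_absorb2)
    also have "\<dots> = (\<Sum>k\<in>grid d m. f (grid_point d m k)) / real m ^ d"
      using measure_grid_cell(2)[OF m] by (simp add: measure_def sum_divide_distrib)
    finally show ?thesis .
  qed
  have lim: "(\<lambda>m. step (Suc m) x) \<longlonglongrightarrow> ?F x" for x
  proof (cases "x \<in> unit_cube d")
    case True
    have cube: "grid_point d (Suc m) (grid_index d (Suc m) x) \<in> unit_cube d" for m
      by (intro grid_point_in_unit_cube grid_index_in_grid True) simp
    then have "(\<lambda>m. f (grid_point d (Suc m) (grid_index d (Suc m) x))) \<longlonglongrightarrow> f x"
      using True grid_index_tendsto by (intro cont) auto
    then show ?thesis using True cube by (simp add: step_eq)
  next
    case False
    then show ?thesis by (simp add: step_eq)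
  qed
  have "(\<lambda>m. integral\<^sup>L ?M (step (Suc m))) \<longlonglongrightarrow> integral\<^sup>L ?M ?F"
  proof (rule integral_dominated_convergence[where w = "\<lambda>x. B * indicator (unit_cube d) x"])
    show "?F \<in> borel_measurable ?M"
      by (rule borel_measurable_LIMSEQ_real[OF lim meas]) simp
    show "integrable ?M (\<lambda>x. B * indicator (unit_cube d) x)"
      by (intro integrable_mult_right integrable_real_indicator measure_unit_cube)
    show "AE x in ?M. norm (step (Suc m) x) \<le> B * indicator (unit_cube d) x" for m
    proof (rule AE_I2)
      fix x
      show "norm (step (Suc m) x) \<le> B * indicator (unit_cube d) x"
        using bounded[OF grid_point_in_unit_cube[OF grid_index_in_grid[of "Suc m" x d]]]
          grid_point_in_unit_cube[OF grid_index_in_grid[of "Suc m" x d]]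
        by (simp add: step_eq)
    qed
    show "step (Suc m) \<in> borel_measurable ?M" for m by (rule meas) simp
    show "AE x in ?M. (\<lambda>m. step (Suc m) x) \<longlonglongrightarrow> ?F x" by (rule AE_I2) (rule lim)
  qed
  then show ?thesis
    by (simp only: int[OF zero_less_Suc] cube_integral_def set_lebesgue_integral_def real_scaleR_def)
qed

section \<open>The worst-case error\<close>

text \<open>A Riemann sum of \<open>eta _ y\<close>, whose integral over the unit interval is \<open>0\<close>. The sum is computed
  exactly: the maximum changes its branch at the index \<open>r\<close>, the ceiling of \<open>m * y\<close>, and the rounding
  error \<open>t\<close> enters only through a bounded term.\<close>
lemma grid_average_eta_1d:
  assumes m: "m > 0" and y: "0 \<le> y" "y < 1"
  shows "\<bar>(\<Sum>k<m. eta (real k / real m) y) / real m\<bar> \<le> 1 / real m"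
proof -
  define r where "r = nat \<lceil>real m * y\<rceil>"
  define t where "t = real r - real m * y"
  have my: "0 \<le> real m * y" using y by simp
  have r: "real r = of_int \<lceil>real m * y\<rceil>" unfolding r_def using my by simp
  have t: "0 \<le> t" "t < 1" unfolding t_def r by linarith+
  have "real m * y < real m" using m y by simp
  then have rm: "r \<le> m" unfolding r_def by (simp add: nat_le_iff ceiling_le_iff)
  have "(\<Sum>k<m. max (real k) (real m * y)) = (\<Sum>k<r. real m * y) + (\<Sum>k=r..<m. real k)"
  proof -
    have "(\<Sum>k<m. max (real k) (real m * y))
        = (\<Sum>k<r. max (real k) (real m * y)) + (\<Sum>k=r..<m. max (real k) (real m * y))"
      using rm by (metis atLeast0LessThan le0 sum.atLeastLessThan_concat)
    moreover have "(\<Sum>k<r. max (real k) (real m * y)) = (\<Sum>k<r. real m * y)"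
    proof (rule sum.cong[OF refl])
      fix k assume "k \<in> {..<r}"
      then have "real k + 1 \<le> real r" by simp
      then show "max (real k) (real m * y) = real m * y" using t unfolding t_def by linarith
    qed
    moreover have "(\<Sum>k=r..<m. max (real k) (real m * y)) = (\<Sum>k=r..<m. real k)"
    proof (rule sum.cong[OF refl])
      fix k assume "k \<in> {r..<m}"
      then have "real r \<le> real k" by simp
      then show "max (real k) (real m * y) = real k" using t unfolding t_def by linarith
    qed
    ultimately show ?thesis by simp
  qed
  moreover have "(\<Sum>k=r..<m. real k) = (\<Sum>k<m. real k) - (\<Sum>k<r. real k)"
    using sum.atLeastLessThan_concat[OF le0 rm, of real] by (simp add: atLeast0LessThan)
  ultimately have maxsum: "(\<Sum>k<m. max (real k) (real m * y))
      = real r * (real m * y) + real m * (real m - 1) / 2 - real r * (real r - 1) / 2"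
    by (simp add: sum_of_nat_lessThan)
  have eta_k: "eta (real k / real m) y
      = (real k)\<^sup>2 / (2 * (real m)\<^sup>2) + y\<^sup>2 / 2 + 1 / 3 - max (real k) (real m * y) / real m" for k
  proof -
    have "max (real k / real m) y = max (real k) (real m * y) / real m"
      using m by (simp add: max_def field_simps)
    then show ?thesis by (simp add: eta_eq_max power_divide add_divide_distrib)
  qed
  have "(\<Sum>k<m. eta (real k / real m) y) = (\<Sum>k<m. (real k)\<^sup>2) / (2 * (real m)\<^sup>2)
      + real m * (y\<^sup>2 / 2 + 1 / 3) - (\<Sum>k<m. max (real k) (real m * y)) / real m"
    unfolding eta_k by (simp add: sum.distrib sum_subtractf sum_divide_distrib algebra_simps)
  also have "\<dots> = (1 / 4 - y / 2) + (1 / 12 - (t - t\<^sup>2) / 2) / real m"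
    unfolding maxsum sum_of_nat_squares_lessThan using m
    by (simp add: t_def field_simps power2_eq_square)
  finally have S: "(\<Sum>k<m. eta (real k / real m) y)
    = (1 / 4 - y / 2) + (1 / 12 - (t - t\<^sup>2) / 2) / real m" .
  have "0 \<le> t\<^sup>2" "t\<^sup>2 \<le> t" using t by (auto simp: power2_eq_square mult_left_le)
  then have "\<bar>1 / 12 - (t - t\<^sup>2) / 2\<bar> \<le> 1 / 2" using t unfolding abs_le_iff by argo
  then have "\<bar>(1 / 12 - (t - t\<^sup>2) / 2) / real m\<bar> \<le> 1 / 2"
    using m by (simp add: abs_divide divide_le_eq)
  moreover have "\<bar>1 / 4 - y / 2\<bar> \<le> 1 / 2" using y by linarith
  ultimately have "\<bar>\<Sum>k<m. eta (real k / real m) y\<bar> \<le> 1" unfolding S by linarith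
  then show ?thesis using m by (simp add: abs_divide divide_right_mono)
qed

lemma grid_average_eta_prod:
  assumes m: "m > 0" and y: "y \<in> unit_cube d" and u: "u \<subseteq> {1..d}" "u \<noteq> {}"
  shows "\<bar>(\<Sum>k\<in>grid d m. \<Prod>j\<in>u. eta (grid_point d m k j) (y j)) / real m ^ d\<bar> \<le> 1 / real m"
proof -
  have fin: "finite u" using u finite_subset by blast
  have "(\<Sum>k\<in>grid d m. \<Prod>j\<in>u. eta (grid_point d m k j) (y j))
      = (\<Sum>k\<in>PiE {1..d} (\<lambda>_. {..<m}). \<Prod>j\<in>u. eta (real (k j) / real m) (y j))"
    unfolding grid_def using u
    by (intro sum.cong prod.cong refl) (auto simp: grid_point_def)
  then have "(\<Sum>k\<in>grid d m. \<Prod>j\<in>u. eta (grid_point d m k j) (y j)) / real m ^ d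
      = (\<Prod>j\<in>u. (\<Sum>k<m. eta (real k / real m) (y j)) / real m)"
    using sum_PiE_prod_subset[of "{1..d}" u "{..<m}" "\<lambda>j k. eta (real k / real m) (y j)"] u m
    by auto
  also have "\<bar>\<dots>\<bar> = (\<Prod>j\<in>u. \<bar>(\<Sum>k<m. eta (real k / real m) (y j)) / real m\<bar>)"
    by (rule abs_prod)
  also have "\<dots> \<le> (\<Prod>j\<in>u. 1 / real m)"
  proof (rule prod_mono, intro conjI grid_average_eta_1d m)
    fix j assume "j \<in> u"
    then have "y j \<in> {0..<1}" using y u by (auto simp: unit_cube_def PiE_iff)
    then show "0 \<le> y j" "y j < 1" by auto
  qed simp
  also have "\<dots> = (1 / real m) ^ card u" by simp
  also have "\<dots> \<le> (1 / real m) ^ 1"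
    using m u fin by (intro power_decreasing) (auto simp: Suc_le_eq card_gt_0_iff)
  finally show ?thesis by simp
qed

text \<open>The grid averages of kernel sections approximate the representer of the integral, which is the
  constant \<open>\<gamma> {}\<close>.\<close>
lemma grid_average_kernel:
  assumes m: "m > 0" and y: "y \<in> unit_cube d" and \<gamma>: "\<And>u. \<gamma> u \<ge> 0"
  shows "\<bar>(\<Sum>k\<in>grid d m. sobolev_kernel d \<gamma> (grid_point d m k) y) / real m ^ d - \<gamma> {}\<bar>
    \<le> (\<Sum>u\<in>Pow {1..d} - {{}}. \<gamma> u) / real m"
proof -
  let ?P = "\<lambda>u k. \<Prod>j\<in>u. eta (grid_point d m k j) (y j)"
  have "(\<Sum>k\<in>grid d m. sobolev_kernel d \<gamma> (grid_point d m k) y) / real m ^ d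
      = (\<Sum>u\<in>Pow {1..d}. \<gamma> u * ((\<Sum>k\<in>grid d m. ?P u k) / real m ^ d))"
    unfolding sobolev_kernel_def
    by (subst sum.swap) (simp add: sum_distrib_left sum_divide_distrib)
  also have "\<dots> = \<gamma> {} * ((\<Sum>k\<in>grid d m. ?P {} k) / real m ^ d)
      + (\<Sum>u\<in>Pow {1..d} - {{}}. \<gamma> u * ((\<Sum>k\<in>grid d m. ?P u k) / real m ^ d))"
    by (rule sum.remove) auto
  also have "\<gamma> {} * ((\<Sum>k\<in>grid d m. ?P {} k) / real m ^ d) = \<gamma> {}"
    using m by (simp add: card_grid)
  finally have "(\<Sum>k\<in>grid d m. sobolev_kernel d \<gamma> (grid_point d m k) y) / real m ^ d - \<gamma> {}
      = (\<Sum>u\<in>Pow {1..d} - {{}}. \<gamma> u * ((\<Sum>k\<in>grid d m. ?P u k) / real m ^ d))"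
    by simp
  also have "\<bar>\<dots>\<bar> \<le> (\<Sum>u\<in>Pow {1..d} - {{}}. \<bar>\<gamma> u * ((\<Sum>k\<in>grid d m. ?P u k) / real m ^ d)\<bar>)"
    by (rule sum_abs)
  also have "\<dots> \<le> (\<Sum>u\<in>Pow {1..d} - {{}}. \<gamma> u * (1 / real m))"
  proof (rule sum_mono)
    fix u assume "u \<in> Pow {1..d} - {{}}"
    then have "\<bar>(\<Sum>k\<in>grid d m. ?P u k) / real m ^ d\<bar> \<le> 1 / real m"
      using grid_average_eta_prod[OF m y] by auto
    then show "\<bar>\<gamma> u * ((\<Sum>k\<in>grid d m. ?P u k) / real m ^ d)\<bar> \<le> \<gamma> u * (1 / real m)"
      using \<gamma>[of u] by (simp only: abs_mult abs_of_nonneg mult_left_mono)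
  qed
  finally show ?thesis by (simp add: sum_divide_distrib)
qed

lemma tendsto_sobolev_kernel:
  assumes "\<And>j. j \<in> {1..d} \<Longrightarrow> ((\<lambda>m. p m j) \<longlongrightarrow> x j) F"
    and "\<And>j. j \<in> {1..d} \<Longrightarrow> ((\<lambda>m. q m j) \<longlongrightarrow> y j) F"
  shows "((\<lambda>m. sobolev_kernel d \<gamma> (p m) (q m)) \<longlongrightarrow> sobolev_kernel d \<gamma> x y) F"
  unfolding sobolev_kernel_def eta_eq_max using assms
  by (intro tendsto_sum tendsto_mult tendsto_prod tendsto_add tendsto_diff tendsto_max
      tendsto_divide tendsto_power tendsto_const) auto

lemma sobolev_kernel_commute: "sobolev_kernel d \<gamma> x y = sobolev_kernel d \<gamma> y x"
  unfolding sobolev_kernel_def by (simp add: eta_commute)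

lemma sobolev_kernel_le:
  assumes "x \<in> unit_cube d" and "\<And>u. \<gamma> u \<ge> 0"
  shows "sobolev_kernel d \<gamma> x x \<le> (\<Sum>u\<in>Pow {1..d}. \<gamma> u)"
  unfolding sobolev_kernel_def
proof (rule sum_mono)
  fix u assume u: "u \<in> Pow {1..d}"
  have "\<bar>\<Prod>j\<in>u. eta (x j) (x j)\<bar> \<le> (\<Prod>j\<in>u. 1)"
    unfolding abs_prod
  proof (rule prod_mono, intro conjI)
    fix j assume "j \<in> u"
    then have "x j \<in> {0..<1}" using u assms(1) by (auto simp: unit_cube_def PiE_iff)
    then show "\<bar>eta (x j) (x j)\<bar> \<le> 1" using abs_eta_le[of "x j" "x j"] by simp
  qed simp
  then show "\<gamma> u * (\<Prod>j\<in>u. eta (x j) (x j)) \<le> \<gamma> u"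
    using assms(2)[of u] by (intro mult_left_le) auto
qed

lemma sobolev_rkhs_bounded:
  assumes "rkhs (unit_cube d) (sobolev_kernel d \<gamma>) H ip" and "\<And>u. \<gamma> u \<ge> 0"
    and "f \<in> H" and "x \<in> unit_cube d"
  shows "\<bar>f x\<bar> \<le> ip_norm ip f * sqrt (\<Sum>u\<in>Pow {1..d}. \<gamma> u)"
proof -
  interpret rkhs "unit_cube d" "sobolev_kernel d \<gamma>" H ip by fact
  have "\<bar>f x\<bar> \<le> ip_norm ip f * sqrt (sobolev_kernel d \<gamma> x x)"
    using evaluation_combination_bound[of f "{()}" "\<lambda>_. x" "\<lambda>_. 1"] assms by simp
  also have "\<dots> \<le> ip_norm ip f * sqrt (\<Sum>u\<in>Pow {1..d}. \<gamma> u)"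
    using sobolev_kernel_le[OF assms(4,2)] ip_ge_zero[OF assms(3)]
    by (intro mult_left_mono real_sqrt_le_mono) (auto simp: ip_norm_def)
  finally show ?thesis .
qed

text \<open>The difference of the evaluations at \<open>p m\<close> and \<open>x\<close> is a combination of two point evaluations,
  whose norm tends to \<open>0\<close> because the kernel is continuous.\<close>
lemma sobolev_rkhs_continuous:
  assumes "rkhs (unit_cube d) (sobolev_kernel d \<gamma>) H ip"
    and f: "f \<in> H" and x: "x \<in> unit_cube d" and p: "\<And>m::nat. p m \<in> unit_cube d"
    and lim: "\<And>j. j \<in> {1..d} \<Longrightarrow> (\<lambda>m. p m j) \<longlonglongrightarrow> x j"
  shows "(\<lambda>m. f (p m)) \<longlonglongrightarrow> f x"
proof -
  interpret rkhs "unit_cube d" "sobolev_kernel d \<gamma>" H ip by fact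
  let ?K = "sobolev_kernel d \<gamma>"
  define g where
    "g m = ip_norm ip f * sqrt (?K (p m) (p m) - ?K (p m) x - ?K x (p m) + ?K x x)" for m
  have "g \<longlonglongrightarrow> ip_norm ip f * sqrt (?K x x - ?K x x - ?K x x + ?K x x)"
    unfolding g_def by (intro tendsto_intros tendsto_sobolev_kernel lim)
  then have "g \<longlonglongrightarrow> 0" by simp
  moreover have "norm (f (p m) - f x) \<le> g m" for m
    using evaluation_combination_bound[OF f, of UNIV "\<lambda>b. if b then p m else x"
        "\<lambda>b. if b then 1 else -1"] x p
    by (simp add: UNIV_bool g_def algebra_simps)
  ultimately have "(\<lambda>m. f (p m) - f x) \<longlonglongrightarrow> 0"
    by (intro Lim_null_comparison[of "\<lambda>m. f (p m) - f x" g] always_eventually allI)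
  then show ?thesis by (rule LIM_zero_cancel)
qed

lemma average_near:
  fixes g :: "'i \<Rightarrow> real"
  assumes "finite S" "S \<noteq> {}" and "\<And>k. k \<in> S \<Longrightarrow> \<bar>g k - c\<bar> \<le> e"
  shows "\<bar>(\<Sum>k\<in>S. g k) / real (card S) - c\<bar> \<le> e"
proof -
  have c: "real (card S) > 0" using assms by (simp add: card_gt_0_iff)
  have "(\<Sum>k\<in>S. g k) / real (card S) - c = (\<Sum>k\<in>S. g k - c) / real (card S)"
    using c by (simp add: sum_subtractf field_simps)
  also have "\<bar>\<dots>\<bar> \<le> (\<Sum>k\<in>S. e) / real (card S)"
    unfolding abs_divide abs_of_nat
    by (intro divide_right_mono order.trans[OF sum_abs] sum_mono assms(3)) auto
  finally show ?thesis using c by simp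
qed

text \<open>\<open>E\<close> is the squared distance between the representer of the integral and that of the quadrature
  rule. It appears as the limit of the squared distances \<open>E'\<close> between the representers of two
  finite rules, where the integral is replaced by the average over a grid; no representer of the
  integral itself has to be constructed.\<close>
lemma quadrature_error_bound:
  assumes R: "rkhs (unit_cube d) (sobolev_kernel d \<gamma>) H ip" and \<gamma>: "\<And>u. \<gamma> u \<ge> 0"
    and n: "n > 0" and x: "\<And>i. i < n \<Longrightarrow> x i \<in> unit_cube d"
  defines "E \<equiv> (\<Sum>i<n. \<Sum>l<n. sobolev_kernel d \<gamma> (x i) (x l)) / (real n)\<^sup>2 - \<gamma> {}"
  shows "0 \<le> E"
    and "f \<in> H \<Longrightarrow> \<bar>cube_integral d f - (\<Sum>i<n. f (x i)) / real n\<bar> \<le> ip_norm ip f * sqrt E"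
proof -
  interpret rkhs "unit_cube d" "sobolev_kernel d \<gamma>" H ip by fact
  let ?K = "sobolev_kernel d \<gamma>"
  define \<Gamma> where "\<Gamma> = (\<Sum>u\<in>Pow {1..d} - {{}}. \<gamma> u)"
  define S :: "nat \<Rightarrow> ((nat \<Rightarrow> nat) + nat) set" where "S m = grid d m <+> {..<n}" for m
  define p where "p m = case_sum (grid_point d m) x" for m
  define w :: "nat \<Rightarrow> (nat \<Rightarrow> nat) + nat \<Rightarrow> real" where
    "w m = case_sum (\<lambda>_. 1 / real m ^ d) (\<lambda>_. - (1 / real n))" for m
  define E' where "E' m = (\<Sum>a\<in>S m. \<Sum>b\<in>S m. w m a * w m b * ?K (p m a) (p m b))" for m
  have fin: "finite (S m)" for m unfolding S_def by (simp add: finite_grid)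
  have pS: "p m a \<in> unit_cube d" if "a \<in> S m" for m a
    using that unfolding S_def p_def by (auto simp: grid_point_in_unit_cube x)
  have wsum: "(\<Sum>a\<in>S m. w m a * h (p m a))
      = (\<Sum>k\<in>grid d m. h (grid_point d m k)) / real m ^ d - (\<Sum>i<n. h (x i)) / real n" for m h
    unfolding S_def by (simp add: sum.Plus finite_grid w_def p_def sum_divide_distrib sum_negf)
  define \<kappa> where "\<kappa> m y = (\<Sum>k\<in>grid d m. ?K (grid_point d m k) y) / real m ^ d" for m y
  have \<kappa>: "\<bar>\<kappa> m y - \<gamma> {}\<bar> \<le> \<Gamma> / real m" if "m > 0" "y \<in> unit_cube d" for m y
    unfolding \<kappa>_def \<Gamma>_def using grid_average_kernel[of m y d \<gamma>] that \<gamma> by blast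
  \<comment> \<open>The pure grid term and the two mixed terms are averages of \<open>\<kappa>\<close>, hence close to
    \<open>\<gamma> {}\<close>; the pure lattice term is \<open>E + \<gamma> {}\<close>.\<close>
  have E'_eq: "E' m = (\<Sum>k\<in>grid d m. \<kappa> m (grid_point d m k)) / real (card (grid d m))
      - 2 * ((\<Sum>i<n. \<kappa> m (x i)) / real (card {..<n})) + (E + \<gamma> {})" for m
  proof -
    let ?q = "\<lambda>y. (\<Sum>i<n. ?K (x i) y) / real n"
    have "E' m = (\<Sum>b\<in>S m. w m b * (\<Sum>a\<in>S m. w m a * ?K (p m a) (p m b)))"
      unfolding E'_def by (subst sum.swap) (simp add: sum_distrib_left mult_ac)
    also have "\<dots> = (\<Sum>b\<in>S m. w m b * (\<kappa> m (p m b) - ?q (p m b)))"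
      using wsum[of m "\<lambda>z. ?K z (p m b)" for b] by (simp add: \<kappa>_def)
    also have "\<dots> = (\<Sum>k\<in>grid d m. \<kappa> m (grid_point d m k) - ?q (grid_point d m k)) / real m ^ d
        - (\<Sum>i<n. \<kappa> m (x i) - ?q (x i)) / real n"
      by (rule wsum)
    finally have "E' m = (\<Sum>k\<in>grid d m. \<kappa> m (grid_point d m k)) / real m ^ d
        - (\<Sum>k\<in>grid d m. ?q (grid_point d m k)) / real m ^ d
        - (\<Sum>i<n. \<kappa> m (x i)) / real n + (\<Sum>i<n. ?q (x i)) / real n"
      by (simp only: sum_subtractf diff_divide_distrib)
    moreover have "(\<Sum>k\<in>grid d m. ?q (grid_point d m k)) / real m ^ d = (\<Sum>i<n. \<kappa> m (x i)) / real n"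
    proof -
      have "(\<Sum>k\<in>grid d m. ?q (grid_point d m k)) / real m ^ d
          = (\<Sum>k\<in>grid d m. \<Sum>i<n. ?K (grid_point d m k) (x i) / (real n * real m ^ d))"
        by (simp only: sum_divide_distrib divide_divide_eq_left sobolev_kernel_commute[of d \<gamma> "x _"])
      also have "\<dots> = (\<Sum>i<n. \<kappa> m (x i)) / real n"
        unfolding \<kappa>_def
        by (subst sum.swap) (simp only: sum_divide_distrib divide_divide_eq_left mult.commute)
      finally show ?thesis .
    qed
    moreover have "(\<Sum>i<n. ?q (x i)) / real n = E + \<gamma> {}"
      unfolding E_def
      by (subst sum.swap, simp add: sum_divide_distrib power2_eq_square)
    ultimately show ?thesis by (simp add: card_grid)
  qed
  have near: "\<bar>E' m - E\<bar> \<le> 3 * \<Gamma> / real m" if m: "m > 0" for m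
  proof -
    have "grid d m \<noteq> {}" using m card_grid[of d m] by (metis card.empty power_not_zero less_not_refl)
    then have "\<bar>(\<Sum>k\<in>grid d m. \<kappa> m (grid_point d m k)) / real (card (grid d m)) - \<gamma> {}\<bar> \<le> \<Gamma> / real m"
      by (intro average_near finite_grid \<kappa> m grid_point_in_unit_cube)
    moreover have "\<bar>(\<Sum>i<n. \<kappa> m (x i)) / real (card {..<n}) - \<gamma> {}\<bar> \<le> \<Gamma> / real m"
      by (intro average_near \<kappa> m x) (use n in auto)
    ultimately show ?thesis unfolding E'_eq[of m] by linarith
  qed
  have "(\<lambda>m. 3 * \<Gamma> / real m) \<longlonglongrightarrow> 0" by (rule lim_const_over_n)
  then have "(\<lambda>m. E' m - E) \<longlonglongrightarrow> 0"
    using near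
    by (intro Lim_null_comparison[of "\<lambda>m. E' m - E" "\<lambda>m. 3 * \<Gamma> / real m"]
        eventually_sequentiallyI[of 1]) auto
  then have "E' \<longlonglongrightarrow> E" by (rule LIM_zero_cancel)
  then have lim: "(\<lambda>m. E' (Suc m)) \<longlonglongrightarrow> E" by (rule LIMSEQ_Suc)
  moreover have "E' m \<ge> 0" for m unfolding E'_def by (rule kernel_form_nonneg[OF fin pS])
  ultimately show "0 \<le> E" by (intro LIMSEQ_le_const[of _ E 0]) auto
  show "\<bar>cube_integral d f - (\<Sum>i<n. f (x i)) / real n\<bar> \<le> ip_norm ip f * sqrt E" if f: "f \<in> H"
  proof (rule LIMSEQ_le)
    show "(\<lambda>m. \<bar>(\<Sum>k\<in>grid d (Suc m). f (grid_point d (Suc m) k)) / real (Suc m) ^ d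
        - (\<Sum>i<n. f (x i)) / real n\<bar>) \<longlonglongrightarrow> \<bar>cube_integral d f - (\<Sum>i<n. f (x i)) / real n\<bar>"
      using sobolev_rkhs_bounded[OF R \<gamma> f] sobolev_rkhs_continuous[OF R f]
      by (intro tendsto_rabs tendsto_diff tendsto_const grid_averages_tendsto_cube_integral) auto
    show "(\<lambda>m. ip_norm ip f * sqrt (E' (Suc m))) \<longlonglongrightarrow> ip_norm ip f * sqrt E"
      by (intro tendsto_intros lim)
    have "\<bar>(\<Sum>k\<in>grid d (Suc m). f (grid_point d (Suc m) k)) / real (Suc m) ^ d
        - (\<Sum>i<n. f (x i)) / real n\<bar> \<le> ip_norm ip f * sqrt (E' (Suc m))" for m
      using evaluation_combination_bound[OF f, where S = "S (Suc m)" and p = "p (Suc m)"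
          and w = "w (Suc m)", OF fin pS]
      unfolding wsum[of "Suc m" f] E'_def .
    then show "\<exists>N. \<forall>m\<ge>N. \<bar>(\<Sum>k\<in>grid d (Suc m). f (grid_point d (Suc m) k)) / real (Suc m) ^ d
        - (\<Sum>i<n. f (x i)) / real n\<bar> \<le> ip_norm ip f * sqrt (E' (Suc m))" by blast
  qed
qed

lemma worst_case_error_squared_le:
  assumes R: "rkhs (unit_cube d) (sobolev_kernel d \<gamma>) H ip" and \<gamma>: "\<And>u. \<gamma> u \<ge> 0"
    and n: "n > 0"
  shows "(worst_case_error H ip d n z)\<^sup>2
    \<le> (\<Sum>i<n. \<Sum>l<n. sobolev_kernel d \<gamma> (lattice_point d n z i) (lattice_point d n z l)) / (real n)\<^sup>2
      - \<gamma> {}"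
proof -
  interpret rkhs "unit_cube d" "sobolev_kernel d \<gamma>" H ip by fact
  let ?E = "(\<Sum>i<n. \<Sum>l<n. sobolev_kernel d \<gamma> (lattice_point d n z i) (lattice_point d n z l)) / (real n)\<^sup>2
      - \<gamma> {}"
  let ?e = "\<lambda>f. \<bar>cube_integral d f - lattice_rule d n z f\<bar>"
  let ?U = "{f \<in> H. ip_norm ip f \<le> 1}"
  have pts: "lattice_point d n z i \<in> unit_cube d" for i
    by (auto simp: lattice_point_def unit_cube_def frac_lt_1)
  have E0: "0 \<le> ?E" by (rule quadrature_error_bound(1)[OF R \<gamma> n pts])
  have bound: "?e f \<le> sqrt ?E" if "f \<in> ?U" for f
  proof -
    have "?e f \<le> ip_norm ip f * sqrt ?E"
      using quadrature_error_bound(2)[OF R \<gamma> n pts, of f] that by (simp add: lattice_rule_def)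
    also have "\<dots> \<le> 1 * sqrt ?E" using that E0 by (intro mult_right_mono) auto
    finally show ?thesis by simp
  qed
  have "ip (\<lambda>_. 0) (\<lambda>_. 0) = 0"
    using ip_scale_left[OF zero_closed zero_closed, of 0] by simp
  then have zero: "(\<lambda>_. 0) \<in> ?U" using zero_closed by (simp add: ip_norm_def)
  have "worst_case_error H ip d n z \<le> sqrt ?E"
    unfolding worst_case_error_def by (rule cSUP_least) (use zero bound in auto)
  moreover have "0 \<le> worst_case_error H ip d n z"
    unfolding worst_case_error_def
    by (rule order.trans[OF _ cSUP_upper[OF zero]]) (auto intro!: bdd_aboveI2 bound)
  ultimately have "(worst_case_error H ip d n z)\<^sup>2 \<le> (sqrt ?E)\<^sup>2" by (intro power_mono)
  then show ?thesis using E0 by simp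
qed

section \<open>Fourier analysis of the sawtooth function modulo n\<close>

text \<open>The value at multiples of \<open>n\<close> is \<open>0\<close> and not \<open>-1/2\<close>; this makes the function odd modulo \<open>n\<close>, so
  that its zeroth Fourier coefficient vanishes.\<close>
definition sawtooth :: "nat \<Rightarrow> nat \<Rightarrow> real" where
  "sawtooth n a = (if n dvd a then 0 else real (a mod n) / real n - 1 / 2)"

definition unity_root :: "nat \<Rightarrow> int \<Rightarrow> complex" where
  "unity_root n a = cis (2 * pi * real_of_int a / real n)"

lemma unity_root_add: "unity_root n (a + b) = unity_root n a * unity_root n b"
  by (simp add: unity_root_def cis_mult ring_distribs add_divide_distrib)

lemma unity_root_power: "unity_root n a ^ k = unity_root n (a * int k)"
  by (simp add: unity_root_def Complex.DeMoivre mult_ac)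

lemma norm_unity_root [simp]: "norm (unity_root n a) = 1"
  by (simp add: unity_root_def)

lemma unity_root_eq_1_iff:
  assumes "n > 0" shows "unity_root n a = 1 \<longleftrightarrow> int n dvd a"
proof
  assume "unity_root n a = 1"
  then have "cos (2 * pi * real_of_int a / real n) = 1"
    by (simp add: unity_root_def complex_eq_iff)
  then obtain k :: int where "2 * pi * real_of_int a / real n = real_of_int k * 2 * pi"
    using cos_one_2pi_int by auto
  then have "real_of_int a = real_of_int (k * int n)" using assms by (simp add: field_simps)
  then have "a = k * int n" by (simp only: of_int_eq_iff)
  then show "int n dvd a" by simp
next
  assume "int n dvd a"
  then obtain k where "a = int n * k" by blast
  then have "2 * pi * real_of_int a / real n = 2 * pi * real_of_int k" using assms by simp
  then show "unity_root n a = 1" by (simp add: unity_root_def)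
qed

lemma sum_unity_root:
  assumes "n > 0"
  shows "(\<Sum>z<n. unity_root n (a * int z)) = (if int n dvd a then of_nat n else 0)"
proof (cases "int n dvd a")
  case True
  then have "unity_root n (a * int z) = 1" for z using unity_root_eq_1_iff assms by auto
  then show ?thesis using True by simp
next
  case False
  then have "unity_root n a \<noteq> 1" using unity_root_eq_1_iff assms by blast
  moreover have "unity_root n a ^ n = 1"
    using unity_root_eq_1_iff[OF assms] by (simp add: unity_root_power)
  ultimately have "(\<Sum>z<n. unity_root n a ^ z) = 0" by (simp add: geometric_sum)
  then show ?thesis using False by (simp add: unity_root_power)
qed

definition sawtooth_dft :: "nat \<Rightarrow> nat \<Rightarrow> complex" where
  "sawtooth_dft n m = (\<Sum>a<n. of_real (sawtooth n a) * unity_root n (- (int m * int a)))"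

lemma sawtooth_dft_inversion:
  assumes n: "n > 0"
  shows "of_real (sawtooth n a) = (\<Sum>m<n. sawtooth_dft n m * unity_root n (int m * int a)) / of_nat n"
proof -
  have "(\<Sum>m<n. sawtooth_dft n m * unity_root n (int m * int a))
      = (\<Sum>m<n. \<Sum>b<n. of_real (sawtooth n b) * unity_root n ((int a - int b) * int m))"
    unfolding sawtooth_dft_def sum_distrib_right
    by (intro sum.cong refl) (simp add: mult.assoc flip: unity_root_add, simp add: algebra_simps)
  also have "\<dots> = (\<Sum>b<n. of_real (sawtooth n b) * (\<Sum>m<n. unity_root n ((int a - int b) * int m)))"
    by (subst sum.swap) (simp add: sum_distrib_left)
  also have "\<dots> = (\<Sum>b<n. if b = a mod n then of_real (sawtooth n b) * of_nat n else 0)"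
  proof (rule sum.cong[OF refl])
    fix b assume "b \<in> {..<n}"
    then have "int n dvd int a - int b \<longleftrightarrow> b = a mod n"
      by (metis lessThan_iff mod_eq_dvd_iff mod_less of_nat_eq_iff of_nat_mod)
    then show "of_real (sawtooth n b) * (\<Sum>m<n. unity_root n ((int a - int b) * int m))
        = (if b = a mod n then complex_of_real (sawtooth n b) * of_nat n else 0)"
      by (simp add: sum_unity_root[OF n])
  qed
  also have "\<dots> = of_real (sawtooth n (a mod n)) * of_nat n" using n by simp
  also have "sawtooth n (a mod n) = sawtooth n a" by (simp add: sawtooth_def dvd_mod_iff)
  finally show ?thesis using n by simp
qed

text \<open>Multiplication by \<open>w - 1\<close> makes the sum telescope.\<close>
lemma arithmetic_geometric_sum:
  fixes w :: complex
  assumes "w \<noteq> 1" "w ^ n = 1"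
  shows "(\<Sum>a<n. of_nat a * w ^ a) = of_nat n / (w - 1)"
proof -
  have "(\<Sum>a<N. of_nat a * w ^ a) * (w - 1) = of_nat N * w ^ N - (\<Sum>a<N. w ^ Suc a)" for N
    by (induction N) (simp_all add: algebra_simps)
  moreover have "(\<Sum>a<n. w ^ Suc a) = w * (\<Sum>a<n. w ^ a)" by (simp add: sum_distrib_left)
  ultimately have "(\<Sum>a<n. of_nat a * w ^ a) * (w - 1) = of_nat n"
    using assms by (simp add: geometric_sum)
  then show ?thesis using assms by (simp add: field_simps)
qed

text \<open>Up to the factor \<open>\<i>/2\<close> this is the cotangent of \<open>pi m / n\<close>. The summand \<open>1/2\<close> comes from the
  value at \<open>0\<close>.\<close>
lemma sawtooth_dft_eq:
  assumes n: "n > 0" and m: "\<not> n dvd m"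
  shows "sawtooth_dft n m = 1 / (unity_root n (- int m) - 1) + 1 / 2"
proof -
  define w where "w = unity_root n (- int m)"
  have w1: "w \<noteq> 1" unfolding w_def using unity_root_eq_1_iff[OF n] m by simp
  have wn: "w ^ n = 1" unfolding w_def using unity_root_eq_1_iff[OF n] by (simp add: unity_root_power)
  have "sawtooth_dft n m = (\<Sum>a<n. of_real (sawtooth n a) * w ^ a)"
    by (simp add: sawtooth_dft_def w_def unity_root_power)
  also have "\<dots> = (\<Sum>a<n. (of_nat a * w ^ a) / of_nat n - w ^ a / 2 + (if a = 0 then 1 / 2 else 0))"
  proof (rule sum.cong[OF refl])
    fix a assume "a \<in> {..<n}"
    then show "of_real (sawtooth n a) * w ^ a
      = (of_nat a * w ^ a) / of_nat n - w ^ a / 2 + (if a = 0 then 1 / 2 else 0)"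
      by (auto simp: sawtooth_def dvd_imp_le left_diff_distrib dest: nat_dvd_not_less)
  qed
  also have "\<dots> = (\<Sum>a<n. of_nat a * w ^ a) / of_nat n - (\<Sum>a<n. w ^ a) / 2 + 1 / 2"
    using n by (simp add: sum.distrib sum_subtractf sum_divide_distrib)
  also have "\<dots> = 1 / (w - 1) + 1 / 2"
    using w1 wn n by (simp add: arithmetic_geometric_sum geometric_sum)
  finally show ?thesis unfolding w_def .
qed

lemma sawtooth_dft_0:
  assumes "n > 0" shows "sawtooth_dft n 0 = 0"
proof -
  have "(\<Sum>a<n. sawtooth n a) = (\<Sum>a<n. real a / real n - 1 / 2 + (if a = 0 then 1 / 2 else 0))"
    by (rule sum.cong) (auto simp: sawtooth_def dest: nat_dvd_not_less)
  also have "\<dots> = (\<Sum>a<n. real a) / real n - real n / 2 + 1 / 2"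
    using assms by (simp add: sum.distrib sum_subtractf sum_divide_distrib)
  also have "\<dots> = 0"
    using assms unfolding sum_of_nat_lessThan by (simp add: field_simps)
  finally have "(\<Sum>a<n. sawtooth n a) = 0" .
  then show ?thesis
    by (simp add: sawtooth_dft_def unity_root_def flip: of_real_sum)
qed

text \<open>Jordan's inequality: by concavity, the sine lies above its chord.\<close>
lemma sin_pi_ge:
  assumes "0 \<le> x" "x \<le> 1 / 2" shows "2 * x \<le> sin (pi * x)"
proof -
  have "concave_on {0..pi} sin"
    unfolding concave_on_def
    by (rule f''_ge0_imp_convex[where f' = "\<lambda>x. - cos x" and f'' = sin])
      (auto intro!: derivative_eq_intros simp: sin_ge_zero)
  then have "(1 - 2 * x) * sin 0 + (2 * x) * sin (pi / 2)
      \<le> sin ((1 - 2 * x) *\<^sub>R 0 + (2 * x) *\<^sub>R (pi / 2))"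
    using assms by (intro concave_onD) (auto)
  then show ?thesis by (simp add: mult.commute)
qed

lemma norm_sawtooth_dft_le:
  assumes m: "0 < m" "2 * m < n"
  shows "norm (sawtooth_dft n m) \<le> real n / (4 * real m)"
    and "norm (sawtooth_dft n (n - m)) \<le> real n / (4 * real m)"
proof -
  have n: "n > 0" using m by simp
  have bound: "norm (sawtooth_dft n k) \<le> real n / (4 * real m)" if k: "k = m \<or> k = n - m" for k
  proof -
    define w where "w = unity_root n (- int k)"
    have ndvd: "\<not> n dvd k"
      using k m by (intro nat_dvd_not_less) auto
    have w1: "w \<noteq> 1" unfolding w_def using unity_root_eq_1_iff[OF n] ndvd by simp
    have "sawtooth_dft n k = (w + 1) / (2 * (w - 1))"
      using w1 sawtooth_dft_eq[OF n ndvd] by (simp add: w_def field_simps)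
    moreover have "norm (w + 1) \<le> 2"
      using norm_triangle_ineq[of w 1] by (simp add: w_def)
    ultimately have *: "norm (sawtooth_dft n k) \<le> 1 / norm (w - 1)"
      using divide_right_mono[of "norm (w + 1)" 2 "2 * norm (w - 1)"]
      by (simp add: norm_divide norm_mult del: right_diff_distrib_numeral)
    have "norm (w - 1) = 2 * \<bar>sin (2 * pi * real_of_int (- int k) / real n / 2)\<bar>"
      unfolding w_def unity_root_def cis_conv_exp by (rule dist_exp_i_1)
    then have "norm (w - 1) = 2 * \<bar>sin (pi * real k / real n)\<bar>" by simp
    moreover have "\<bar>sin (pi * real k / real n)\<bar> = \<bar>sin (pi * (real m / real n))\<bar>"
    proof (cases "k = m")
      case False
      then have "real k = real n - real m" using k m by simp
      then have "pi * real k / real n = pi - pi * (real m / real n)"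
        using n by (simp add: right_diff_distrib diff_divide_distrib)
      then show ?thesis by simp
    qed simp
    moreover have "2 * (real m / real n) \<le> sin (pi * (real m / real n))"
      using m by (intro sin_pi_ge) (auto simp: field_simps)
    ultimately have "4 * real m / real n \<le> norm (w - 1)" by linarith
    then have "1 / norm (w - 1) \<le> 1 / (4 * real m / real n)"
      using m n by (intro divide_left_mono) (auto simp: w1)
    then show ?thesis using * by simp
  qed
  show "norm (sawtooth_dft n m) \<le> real n / (4 * real m)"
    and "norm (sawtooth_dft n (n - m)) \<le> real n / (4 * real m)"
    using bound by auto
qed

text \<open>Here \<open>1 / k\<close> is at most \<open>ln (2 k + 1) - ln (2 k - 1)\<close>, the integral of \<open>1 / t\<close> over the interval
  of length \<open>2\<close> centred at \<open>2 k\<close>, and these differences telescope. With \<open>n = 2 N + 1\<close> the bound is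
  exactly \<open>ln n\<close>, without an additive constant.\<close>
lemma harmonic_le_ln: "(\<Sum>k=1..N. 1 / real k) \<le> ln (real (2 * N + 1))"
proof (induction N)
  case (Suc N)
  have "1 / real (Suc N) \<le> ln (real (2 * N + 3)) - ln (real (2 * N + 1))"
    using ln_inverse_approx_ge[of "real (2 * N + 1)" "real (2 * N + 3)"] by (simp add: field_simps)
  then show ?case using Suc by (simp add: algebra_simps)
qed simp

lemma sum_norm_sawtooth_dft_le:
  assumes n: "odd n"
  shows "(\<Sum>m<n. norm (sawtooth_dft n m)) \<le> real n / 2 * ln (real n)"
proof -
  obtain N where N: "n = 2 * N + 1" using n oddE by blast
  let ?F = "\<lambda>m. norm (sawtooth_dft n m)"
  have "(\<Sum>m<n. ?F m) = ?F 0 + (\<Sum>m=1..N. ?F m) + (\<Sum>m=1..N. ?F (n - m))"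
  proof -
    have "{..<n} = {0} \<union> {1..N} \<union> (\<lambda>m. n - m) ` {1..N}"
    proof (intro equalityI subsetI)
      fix x assume x: "x \<in> {..<n}"
      show "x \<in> {0} \<union> {1..N} \<union> (\<lambda>m. n - m) ` {1..N}"
      proof (cases "x \<le> N")
        case False
        then have "x = n - (n - x)" "n - x \<in> {1..N}" using x N by auto
        then show ?thesis by blast
      qed auto
    qed (use N in auto)
    then have "(\<Sum>m<n. ?F m) = sum ?F ({0} \<union> {1..N} \<union> (\<lambda>m. n - m) ` {1..N})" by simp
    also have "\<dots> = sum ?F ({0} \<union> {1..N}) + sum ?F ((\<lambda>m. n - m) ` {1..N})"
      by (rule sum.union_disjoint) (use N in auto)
    also have "sum ?F ((\<lambda>m. n - m) ` {1..N}) = (\<Sum>m=1..N. ?F (n - m))"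
      by (subst sum.reindex) (use N in \<open>auto simp: inj_on_def\<close>)
    finally show ?thesis by simp
  qed
  also have "\<dots> \<le> 0 + (\<Sum>m=1..N. real n / (4 * real m)) + (\<Sum>m=1..N. real n / (4 * real m))"
    by (intro add_mono sum_mono norm_sawtooth_dft_le) (use N sawtooth_dft_0[of n] in auto)
  also have "\<dots> = real n / 2 * (\<Sum>m=1..N. 1 / real m)"
    by (simp add: sum_distrib_left field_simps flip: sum.distrib)
  also have "\<dots> \<le> real n / 2 * ln (real n)"
    using harmonic_le_ln[of N] unfolding N by (intro mult_left_mono) auto
  finally show ?thesis .
qed

lemma sawtooth_correlation_dft:
  assumes n: "n > 0"
  shows "complex_of_real (\<Sum>z<n. sawtooth n (i * z) * sawtooth n (k * z))
      = (\<Sum>m<n. \<Sum>l<n. if n dvd m * i + l * k then sawtooth_dft n m * sawtooth_dft n l else 0)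
        / of_nat n"
proof -
  let ?F = "sawtooth_dft n"
  have product: "complex_of_real (sawtooth n (i * z) * sawtooth n (k * z))
      = (\<Sum>m<n. \<Sum>l<n. ?F m * ?F l * unity_root n (int (m * i + l * k) * int z)) / (of_nat n)\<^sup>2" for z
  proof -
    have root: "unity_root n (int m * int (i * z)) * unity_root n (int l * int (k * z))
        = unity_root n (int (m * i + l * k) * int z)" for m l
      by (simp add: algebra_simps flip: unity_root_add)
    then have "(\<Sum>m<n. ?F m * unity_root n (int m * int (i * z)))
        * (\<Sum>l<n. ?F l * unity_root n (int l * int (k * z)))
        = (\<Sum>m<n. \<Sum>l<n. ?F m * ?F l * unity_root n (int (m * i + l * k) * int z))"
      unfolding sum_product
      by (intro sum.cong refl, subst root[symmetric]) (simp only: mult_ac)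
    then show ?thesis
      unfolding of_real_mult sawtooth_dft_inversion[OF n]
      by (simp only: times_divide_times_eq power2_eq_square)
  qed
  have inner: "(\<Sum>z<n. ?F m * ?F l * unity_root n (int (m * i + l * k) * int z))
      = (if n dvd m * i + l * k then ?F m * ?F l else 0) * of_nat n" for m l
    unfolding sum_distrib_left[symmetric] sum_unity_root[OF n] int_dvd_int_iff by simp
  have "complex_of_real (\<Sum>z<n. sawtooth n (i * z) * sawtooth n (k * z))
      = (\<Sum>z<n. \<Sum>m<n. \<Sum>l<n. ?F m * ?F l * unity_root n (int (m * i + l * k) * int z)) / (of_nat n)\<^sup>2"
    unfolding of_real_sum product by (simp only: sum_divide_distrib)
  also have "\<dots> = (\<Sum>m<n. \<Sum>l<n. if n dvd m * i + l * k then ?F m * ?F l else 0) * of_nat n / (of_nat n)\<^sup>2"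
    by (subst sum_rotate) (simp only: inner sum_distrib_right)
  finally show ?thesis using n by (simp only: power2_eq_square) simp
qed

text \<open>The key estimate. After the triangle inequality the sum over \<open>k\<close> can be carried out first:
  for each pair of frequencies \<open>m\<close> and \<open>l \<noteq> 0\<close> only one \<open>k\<close> satisfies the congruence, and \<open>l = 0\<close> does
  not contribute because the zeroth coefficient vanishes. The remaining double sum over \<open>m\<close> and \<open>l\<close>
  is a square.\<close>
lemma sum_abs_sawtooth_correlation_le:
  assumes p: "prime n" "odd n"
  shows "(\<Sum>k=1..<n. \<bar>\<Sum>z<n. sawtooth n (i * z) * sawtooth n (k * z)\<bar>) \<le> real n / 4 * (ln (real n))\<^sup>2"
proof -
  let ?F = "sawtooth_dft n"
  have n: "n > 0" using p prime_gt_0_nat by blast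
  have "\<bar>\<Sum>z<n. sawtooth n (i * z) * sawtooth n (k * z)\<bar>
      \<le> (\<Sum>m<n. \<Sum>l<n. if n dvd m * i + l * k then norm (?F m) * norm (?F l) else 0) / real n" for k
  proof -
    have "\<bar>\<Sum>z<n. sawtooth n (i * z) * sawtooth n (k * z)\<bar>
      = norm (complex_of_real (\<Sum>z<n. sawtooth n (i * z) * sawtooth n (k * z)))"
      by (simp only: norm_of_real)
    also have "\<dots> = norm (\<Sum>m<n. \<Sum>l<n. if n dvd m * i + l * k then ?F m * ?F l else 0) / real n"
      unfolding sawtooth_correlation_dft[OF n] norm_divide norm_of_nat ..
    also have "\<dots> \<le> (\<Sum>m<n. \<Sum>l<n. norm (if n dvd m * i + l * k then ?F m * ?F l else 0)) / real n"
      by (intro divide_right_mono order.trans[OF norm_sum] sum_mono) auto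
    finally show ?thesis by (simp only: if_distrib[of norm] norm_mult norm_zero)
  qed
  then have "(\<Sum>k=1..<n. \<bar>\<Sum>z<n. sawtooth n (i * z) * sawtooth n (k * z)\<bar>)
    \<le> (\<Sum>k=1..<n. (\<Sum>m<n. \<Sum>l<n. if n dvd m * i + l * k then norm (?F m) * norm (?F l) else 0) / real n)"
    by (rule sum_mono)
  also have "\<dots> = (\<Sum>m<n. \<Sum>l<n. \<Sum>k=1..<n. if n dvd m * i + l * k then norm (?F m) * norm (?F l) else 0) / real n"
    unfolding sum_divide_distrib[symmetric] by (subst sum_rotate) (rule refl)
  also have "\<dots> \<le> (\<Sum>m<n. \<Sum>l<n. norm (?F m) * norm (?F l)) / real n"
  proof (intro divide_right_mono sum_mono)
    fix m l assume ml: "m \<in> {..<n}" "l \<in> {..<n}"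
    show "(\<Sum>k=1..<n. if n dvd m * i + l * k then norm (?F m) * norm (?F l) else 0)
        \<le> norm (?F m) * norm (?F l)"
    proof (cases "l = 0")
      case True
      then show ?thesis by (simp add: sawtooth_dft_0[OF n])
    next
      case False
      have uniq: "k = k'" if "n dvd m * i + l * k" "n dvd m * i + l * k'" "k \<in> {1..<n}" "k' \<in> {1..<n}" for k k'
      proof -
        have "int n dvd int (m * i + l * k) - int (m * i + l * k')"
          using that(1,2) by (intro dvd_diff) (simp_all only: int_dvd_int_iff)
        then have "int n dvd int l * (int k - int k')" by (simp add: algebra_simps)
        moreover have "\<not> n dvd l" using ml False by (auto dest: nat_dvd_not_less)
        ultimately show "k = k'" using that(3,4) by (intro prime_mult_diff_cancel[OF p(1)]) auto
      qed
      then have "card {k \<in> {1..<n}. n dvd m * i + l * k} \<le> 1"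
        unfolding One_nat_def by (subst card_le_Suc0_iff_eq) auto
      moreover have "(\<Sum>k=1..<n. if n dvd m * i + l * k then norm (?F m) * norm (?F l) else 0)
         = real (card {k \<in> {1..<n}. n dvd m * i + l * k}) * (norm (?F m) * norm (?F l))"
        by (subst sum.inter_filter[symmetric]) auto
      ultimately show ?thesis by (simp add: mult_left_le_one_le)
    qed
  qed simp
  also have "\<dots> = (\<Sum>m<n. norm (?F m))\<^sup>2 / real n"
    by (simp add: power2_eq_square sum_product)
  also have "\<dots> \<le> (real n / 2 * ln (real n))\<^sup>2 / real n"
    using sum_norm_sawtooth_dft_le[OF p(2)] by (intro divide_right_mono power_mono sum_nonneg) auto
  also have "\<dots> = real n / 4 * (ln (real n))\<^sup>2" using n by (simp add: power2_eq_square)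
  finally show ?thesis .
qed

section \<open>Kernel sums along lattice points\<close>

lemma bij_betw_mult_mod_prime:
  fixes n :: nat
  assumes "prime n" "\<not> n dvd h"
  shows "bij_betw (\<lambda>z. h * z mod n) {1..<n} {1..<n}"
proof -
  have inj: "inj_on (\<lambda>z. h * z mod n) {1..<n}"
  proof (rule inj_onI)
    fix y z assume yz: "y \<in> {1..<n}" "z \<in> {1..<n}" and eq: "h * y mod n = h * z mod n"
    have "int (h * y) mod int n = int (h * z) mod int n" using eq by (metis zmod_int)
    then have "int n dvd int h * (int y - int z)"
      by (simp add: mod_eq_dvd_iff right_diff_distrib)
    then show "y = z" using yz by (intro prime_mult_diff_cancel[OF assms]) auto
  qed
  have "h * z mod n \<in> {1..<n}" if "z \<in> {1..<n}" for z
  proof -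
    have "\<not> n dvd z" using that by (auto dest: nat_dvd_not_less)
    then have "\<not> n dvd h * z" using assms prime_dvd_mult_iff by blast
    then show ?thesis using that by (simp add: Suc_le_eq dvd_eq_mod_eq_0)
  qed
  then have "(\<lambda>z. h * z mod n) ` {1..<n} = {1..<n}"
    using inj by (intro endo_inj_surj) auto
  then show ?thesis using inj by (simp add: bij_betw_def)
qed

lemma bernoulli2_reflect: "bernoulli2 (1 - t) = bernoulli2 t"
  by (simp add: bernoulli2_def power2_eq_square algebra_simps)

lemma sum_bernoulli2_grid:
  assumes "n > 0"
  shows "(\<Sum>z=1..<n. bernoulli2 (real z / real n)) = - (real n - 1) / (6 * real n)"
proof -
  have "{..<n} = insert 0 {1..<n}" using assms by auto
  then have "1 / 6 + (\<Sum>z=1..<n. bernoulli2 (real z / real n))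
      = (\<Sum>z<n. bernoulli2 (real z / real n))"
    by (simp add: bernoulli2_def)
  also have "(\<Sum>z<n. bernoulli2 (real z / real n))
      = (\<Sum>z<n. (real z)\<^sup>2) / (real n)\<^sup>2 - (\<Sum>z<n. real z) / real n + real n / 6"
    by (simp add: bernoulli2_def power_divide sum.distrib sum_subtractf sum_divide_distrib)
  also have "\<dots> = 1 / (6 * real n)"
    using assms unfolding sum_of_nat_lessThan sum_of_nat_squares_lessThan
    by (simp add: field_simps power2_eq_square)
  finally show ?thesis using assms by (simp add: field_simps)
qed

text \<open>The sum over \<open>z\<close> runs over the possible components of a generating vector.\<close>
definition lattice_eta_sum :: "nat \<Rightarrow> nat \<Rightarrow> nat \<Rightarrow> real" where
  "lattice_eta_sum n i k
    = (\<Sum>z=1..<n. eta (frac (real i * real z / real n)) (frac (real k * real z / real n)))"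

lemma abs_lattice_eta_sum_le:
  assumes "n > 0" shows "\<bar>lattice_eta_sum n i k\<bar> \<le> (real n - 1) / 3"
proof -
  have "\<bar>lattice_eta_sum n i k\<bar> \<le> (\<Sum>z=1..<n. 1 / 3)"
    unfolding lattice_eta_sum_def
    by (intro order.trans[OF sum_abs] sum_mono abs_eta_le) (simp_all add: frac_lt_1 less_imp_le)
  then show ?thesis using assms by (simp add: of_nat_diff)
qed

text \<open>The \<open>bernoulli2\<close> part depends on \<open>(i - k) z\<close> modulo \<open>n\<close> only, by the symmetry of \<open>bernoulli2\<close> about
  \<open>1/2\<close>. This residue runs through all nonzero residues with \<open>z\<close>, so that part sums to a constant. The
  \<open>bernoulli1\<close> part is the sawtooth correlation, a Dedekind sum.\<close>
lemma lattice_eta_sum_eq: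
  assumes p: "prime n" and i: "i \<in> {1..<n}" and k: "k \<in> {1..<n}" and ik: "i \<noteq> k"
  shows "lattice_eta_sum n i k
    = (\<Sum>z<n. sawtooth n (i * z) * sawtooth n (k * z)) - (real n - 1) / (12 * real n)"
proof -
  have n: "n > 0" using p prime_gt_0_nat by blast
  \<comment> \<open>A natural number congruent to \<open>i - k\<close>.\<close>
  define h where "h = i + (n - k)"
  have h: "int h = int i - int k + int n" using k by (simp add: h_def of_nat_diff)
  have hn: "\<not> n dvd h"
  proof
    assume "n dvd h"
    then have "int n dvd int i - int k" using h by (metis dvd_add_triv_right_iff int_dvd_int_iff)
    then have "\<bar>int n\<bar> \<le> \<bar>int i - int k\<bar>" using ik by (intro dvd_imp_le_int) auto
    then show False using i k by auto
  qed
  have "eta (frac (real i * real z / real n)) (frac (real k * real z / real n))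
      = bernoulli2 (real (h * z mod n) / real n) / 2 + sawtooth n (i * z) * sawtooth n (k * z)"
    if z: "z \<in> {1..<n}" for z
  proof -
    define a b where "a = i * z mod n" and "b = k * z mod n"
    have fr: "frac (real i * real z / real n) = real a / real n"
      "frac (real k * real z / real n) = real b / real n"
      using frac_of_nat_divide[of "i * z" n] frac_of_nat_divide[of "k * z" n]
      by (simp_all add: a_def b_def)
    have nd: "\<not> n dvd c * z" if "c \<in> {1..<n}" for c
      using that z p prime_dvd_mult_iff[of n c z] by (auto dest: nat_dvd_not_less)
    have saw: "bernoulli1 (real a / real n) = sawtooth n (i * z)"
      "bernoulli1 (real b / real n) = sawtooth n (k * z)"
      using nd[OF i] nd[OF k] by (simp_all add: bernoulli1_def sawtooth_def a_def b_def)
    have ab: "a < n" "b < n" using n by (simp_all add: a_def b_def)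
    have "int (h * z) = int (i * z) - int (k * z) + int n * int z"
      unfolding of_nat_mult h by (simp add: algebra_simps)
    then have "int (h * z) mod int n = (int (i * z) - int (k * z)) mod int n" by simp
    also have "\<dots> = (int a - int b) mod int n"
      unfolding a_def b_def by (simp add: zmod_int mod_diff_eq)
    finally have hz: "int (h * z mod n) = (int a - int b) mod int n" by (simp add: zmod_int)
    have "bernoulli2 \<bar>real a / real n - real b / real n\<bar> = bernoulli2 (real (h * z mod n) / real n)"
    proof (cases "b \<le> a")
      case True
      then have "(int a - int b) mod int n = int a - int b" using ab by (intro mod_pos_pos_trivial) auto
      then have "real (h * z mod n) = real a - real b" using hz by linarith
      moreover have "\<bar>real a / real n - real b / real n\<bar> = real a / real n - real b / real n"
        using True n by (simp add: divide_right_mono)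
      ultimately show ?thesis by (simp add: diff_divide_distrib)
    next
      case False
      have "(int a - int b + int n) mod int n = int a - int b + int n"
        using ab False by (intro mod_pos_pos_trivial) auto
      then have "(int a - int b) mod int n = int a - int b + int n" by simp
      then have "real (h * z mod n) = real a - real b + real n" using hz by linarith
      then have "real (h * z mod n) / real n = 1 - (real b / real n - real a / real n)"
        using n by (simp add: field_simps)
      moreover have "\<bar>real a / real n - real b / real n\<bar> = real b / real n - real a / real n"
        using False n by (simp add: divide_right_mono)
      ultimately show ?thesis by (simp only: bernoulli2_reflect)
    qed
    then show ?thesis unfolding eta_def fr saw by simp
  qed
  then have "lattice_eta_sum n i k = (\<Sum>z=1..<n. bernoulli2 (real (h * z mod n) / real n)) / 2
      + (\<Sum>z=1..<n. sawtooth n (i * z) * sawtooth n (k * z))"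
    unfolding lattice_eta_sum_def by (simp add: sum.distrib sum_divide_distrib)
  also have "(\<Sum>z=1..<n. bernoulli2 (real (h * z mod n) / real n))
      = (\<Sum>z=1..<n. bernoulli2 (real z / real n))"
    by (rule sum.reindex_bij_betw[OF bij_betw_mult_mod_prime[OF p hn]])
  also have "\<dots> = - (real n - 1) / (6 * real n)" by (rule sum_bernoulli2_grid[OF n])
  also have "(\<Sum>z=1..<n. sawtooth n (i * z) * sawtooth n (k * z))
      = (\<Sum>z<n. sawtooth n (i * z) * sawtooth n (k * z))"
    by (rule sum.mono_neutral_left) (auto simp: sawtooth_def not_le Suc_le_eq)
  finally show ?thesis using n by (simp add: field_simps)
qed

text \<open>The two columns \<open>k = 0\<close> and \<open>k = i\<close> are bounded trivially; the others are sawtooth correlations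
  up to a constant.\<close>
lemma sum_abs_lattice_eta_sum_row_le:
  assumes p: "prime n" "odd n" and i: "i \<in> {1..<n}"
  shows "(\<Sum>k<n. \<bar>lattice_eta_sum n i k\<bar>) \<le> (real n - 1) * (3 / 4) + real n / 4 * (ln (real n))\<^sup>2"
proof -
  have n: "n > 0" using p prime_gt_0_nat by blast
  let ?s = "\<lambda>k. \<bar>\<Sum>z<n. sawtooth n (i * z) * sawtooth n (k * z)\<bar>"
  let ?c = "(real n - 1) / (12 * real n)"
  have c: "0 \<le> ?c" using n by simp
  have t: "0 \<le> (real n - 1) / 3" using n by simp
  have "(\<Sum>k<n. \<bar>lattice_eta_sum n i k\<bar>)
      \<le> (\<Sum>k<n. (if k = 0 then (real n - 1) / 3 else 0) + (if k = i then (real n - 1) / 3 else 0)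
          + ?c + (if k \<in> {1..<n} then ?s k else 0))"
  proof (rule sum_mono)
    fix k assume k: "k \<in> {..<n}"
    show "\<bar>lattice_eta_sum n i k\<bar>
      \<le> (if k = 0 then (real n - 1) / 3 else 0) + (if k = i then (real n - 1) / 3 else 0)
          + ?c + (if k \<in> {1..<n} then ?s k else 0)"
    proof (cases "k = 0 \<or> k = i")
      case True
      then have "(real n - 1) / 3
          \<le> (if k = 0 then (real n - 1) / 3 else 0) + (if k = i then (real n - 1) / 3 else 0)"
        using t by auto
      moreover have "0 \<le> (if k \<in> {1..<n} then ?s k else 0)" by simp
      ultimately show ?thesis using abs_lattice_eta_sum_le[OF n, of i k] c by linarith
    next
      case False
      then have k1: "k \<in> {1..<n}" using k by auto
      have "\<bar>lattice_eta_sum n i k\<bar> \<le> ?s k + \<bar>?c\<bar>"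
        using lattice_eta_sum_eq[OF p(1) i k1] False by (metis abs_triangle_ineq4)
      then show ?thesis using False k1 c by (simp only: abs_of_nonneg if_True if_False simp_thms) simp
    qed
  qed
  also have "\<dots> = (real n - 1) / 3 + (real n - 1) / 3 + real n * ?c + (\<Sum>k=1..<n. ?s k)"
  proof -
    have "(\<Sum>k<n. if k \<in> {1..<n} then ?s k else 0) = (\<Sum>k=1..<n. ?s k)"
      by (intro sum.mono_neutral_cong_right) auto
    then show ?thesis using n i by (simp add: sum.distrib)
  qed
  also have "\<dots> \<le> (real n - 1) / 3 + (real n - 1) / 3 + real n * ?c + real n / 4 * (ln (real n))\<^sup>2"
    using sum_abs_sawtooth_correlation_le[OF p, of i] by simp
  also have "\<dots> = (real n - 1) * (3 / 4) + real n / 4 * (ln (real n))\<^sup>2"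
    using n by (simp add: field_simps)
  finally show ?thesis .
qed

lemma sum_abs_lattice_eta_sum_le:
  assumes p: "prime n" "odd n"
  shows "(\<Sum>i<n. \<Sum>k<n. \<bar>lattice_eta_sum n i k\<bar>)
    \<le> (real n - 1) * real n * (13 / 12 + (ln (real n))\<^sup>2 / 4)"
proof -
  have n: "n > 0" using p prime_gt_0_nat by blast
  have "{..<n} = insert 0 {1..<n}" using n by auto
  then have "(\<Sum>i<n. \<Sum>k<n. \<bar>lattice_eta_sum n i k\<bar>)
      = (\<Sum>k<n. \<bar>lattice_eta_sum n 0 k\<bar>) + (\<Sum>i=1..<n. \<Sum>k<n. \<bar>lattice_eta_sum n i k\<bar>)"
    by simp
  also have "\<dots> \<le> (\<Sum>k<n. (real n - 1) / 3)
      + (\<Sum>i=1..<n. (real n - 1) * (3 / 4) + real n / 4 * (ln (real n))\<^sup>2)"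
    by (intro add_mono sum_mono abs_lattice_eta_sum_le[OF n] sum_abs_lattice_eta_sum_row_le[OF p])
  also have "\<dots> = (real n - 1) * (real n / 3 + (real n - 1) * (3 / 4) + real n / 4 * (ln (real n))\<^sup>2)"
    using n by (simp add: of_nat_diff algebra_simps)
  also have "\<dots> \<le> (real n - 1) * (real n * (13 / 12 + (ln (real n))\<^sup>2 / 4))"
    using n by (intro mult_left_mono) (auto simp: algebra_simps)
  finally show ?thesis by (simp add: mult.assoc)
qed

section \<open>The mean squared worst-case error\<close>

text \<open>One logarithm is traded for \<open>sqrt n\<close> through \<open>ln n = 2 * ln (sqrt n) \<le> 2 * (sqrt n - 1)\<close>.\<close>
lemma log_squared_over_n_le:
  fixes n :: nat assumes n: "n \<ge> 3"
  shows "3 * (13 / 12 + (ln (real n))\<^sup>2 / 4) / real n \<le> 4 * (ln (real n) / sqrt (real n))"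
proof -
  let ?L = "ln (real n)" and ?r = "sqrt (real n)"
  have "exp 1 \<le> real n" using exp_le n by linarith
  then have L: "1 \<le> ?L" using n by (simp add: ln_ge_iff)
  have r: "1 \<le> ?r" using n by simp
  have "ln ?r \<le> ?r - 1" using n by (intro ln_le_minus_one) simp
  then have L2: "?L \<le> 2 * (?r - 1)" using n by (simp add: ln_sqrt)
  have "3 * (13 / 12 + ?L\<^sup>2 / 4) = 13 / 4 + 3 / 4 * (?L * ?L)" by (simp add: power2_eq_square)
  also have "\<dots> \<le> 13 / 4 * ?L + 3 / 4 * (?L * (2 * (?r - 1)))"
    using L L2 by (intro add_mono mult_left_mono) auto
  also have "\<dots> = ?L * (7 / 4 + 3 / 2 * ?r)" by (simp add: algebra_simps)
  also have "\<dots> \<le> ?L * (4 * ?r)" using L r by (intro mult_left_mono) linarith+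
  finally have "3 * (13 / 12 + ?L\<^sup>2 / 4) / real n \<le> 4 * ?L * ?r / real n"
    using n by (intro divide_right_mono) (auto simp: mult_ac)
  also have "\<dots> = 4 * ?L * ?r / (?r * ?r)" by simp
  also have "\<dots> = 4 * (?L / ?r)" using r by (simp add: field_simps)
  finally show ?thesis .
qed

lemma C_const_ge: "4 * (1 / 3) ^ card u \<le> C_const u"
proof -
  have "(1 / 3 :: real) ^ card u \<le> (23 / 24) ^ card u" by (rule power_mono) auto
  moreover have "0 \<le> (3 / pi\<^sup>2 + 5 / 6 :: real) ^ card u" by simp
  moreover have "0 \<le> (2 :: real) / 3 ^ card u" "0 \<le> (1 :: real) / 4 ^ card u" by simp_all
  ultimately show ?thesis unfolding C_const_def by linarith
qed

text \<open>All but one factor of the power are bounded by \<open>1/3\<close>, which leaves the mean of absolute values.\<close>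
lemma lattice_eta_power_mean_le:
  assumes p: "prime n" "odd n" and u: "finite u" "u \<noteq> {}"
  shows "(\<Sum>i<n. \<Sum>k<n. (lattice_eta_sum n i k / (real n - 1)) ^ card u) / (real n)\<^sup>2
    \<le> ln (real n) / sqrt (real n) * C_const u"
proof -
  have n: "n \<ge> 3" using p prime_ge_2_nat[of n] by (cases "n = 2") auto
  then have n1: "real n - 1 > 0" by simp
  let ?A = "\<lambda>i k. lattice_eta_sum n i k / (real n - 1)"
  obtain s where s: "card u = Suc s" using u by (metis card_gt_0_iff gr0_implies_Suc)
  have A: "?A i k ^ Suc s \<le> (1 / 3) ^ s * (\<bar>lattice_eta_sum n i k\<bar> / (real n - 1))" for i k
  proof -
    have "\<bar>?A i k\<bar> \<le> 1 / 3"
      using abs_lattice_eta_sum_le[of n i k] n n1 by (simp add: abs_divide divide_le_eq)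
    then have le: "\<bar>?A i k\<bar> ^ s * \<bar>?A i k\<bar> \<le> (1 / 3) ^ s * \<bar>?A i k\<bar>"
      by (intro mult_right_mono power_mono) auto
    have "?A i k ^ Suc s \<le> \<bar>?A i k ^ Suc s\<bar>" by (rule abs_ge_self)
    also have "\<dots> = \<bar>?A i k\<bar> ^ s * \<bar>?A i k\<bar>"
      by (simp only: power_Suc2 abs_mult power_abs)
    also note le
    also have "\<bar>?A i k\<bar> = \<bar>lattice_eta_sum n i k\<bar> / (real n - 1)" using n1 by simp
    finally show ?thesis .
  qed
  have scale: "(1 / 3) ^ s * ((real n - 1) * real n * Q / ((real n - 1) * (real n)\<^sup>2))
      = (1 / 3) ^ card u * (3 * Q / real n)" for Q
    using n1 n unfolding s by (simp add: power2_eq_square)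
  have "(\<Sum>i<n. \<Sum>k<n. ?A i k ^ card u) / (real n)\<^sup>2
      \<le> (\<Sum>i<n. \<Sum>k<n. (1 / 3) ^ s * (\<bar>lattice_eta_sum n i k\<bar> / (real n - 1))) / (real n)\<^sup>2"
    unfolding s by (intro divide_right_mono sum_mono A) simp
  also have "\<dots> = (1 / 3) ^ s * ((\<Sum>i<n. \<Sum>k<n. \<bar>lattice_eta_sum n i k\<bar>) / ((real n - 1) * (real n)\<^sup>2))"
    by (simp add: sum_distrib_left sum_divide_distrib)
  also have "\<dots> \<le> (1 / 3) ^ s * ((real n - 1) * real n * (13 / 12 + (ln (real n))\<^sup>2 / 4)
      / ((real n - 1) * (real n)\<^sup>2))"
    using n1 by (intro mult_left_mono divide_right_mono sum_abs_lattice_eta_sum_le[OF p]) auto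
  also have "(1 / 3) ^ s * ((real n - 1) * real n * (13 / 12 + (ln (real n))\<^sup>2 / 4)
        / ((real n - 1) * (real n)\<^sup>2))
      = (1 / 3) ^ card u * (3 * (13 / 12 + (ln (real n))\<^sup>2 / 4) / real n)"
    by (rule scale)
  also have "\<dots> \<le> (1 / 3) ^ card u * (4 * (ln (real n) / sqrt (real n)))"
    by (intro mult_left_mono log_squared_over_n_le n) simp
  also have "\<dots> = ln (real n) / sqrt (real n) * (4 * (1 / 3) ^ card u)" by simp
  also have "\<dots> \<le> ln (real n) / sqrt (real n) * C_const u"
    using n by (intro mult_left_mono C_const_ge) auto
  finally show ?thesis .
qed

text \<open>The term for the empty set in the kernel is \<open>\<gamma> {}\<close>, which cancels; every other term is a
  product over coordinates, and its mean over \<open>z\<close> is a product of one-dimensional means, which all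
  agree.\<close>
lemma mean_kernel_excess_eq:
  assumes n: "n \<ge> 2"
  shows "(\<Sum>z\<in>PiE {1..d} (\<lambda>_. {1..n - 1}).
      (\<Sum>i<n. \<Sum>l<n. sobolev_kernel d \<gamma> (lattice_point d n z i) (lattice_point d n z l)) / (real n)\<^sup>2
      - \<gamma> {}) / (real n - 1) ^ d
    = (\<Sum>u | u \<noteq> {} \<and> u \<subseteq> {1..d}.
        \<gamma> u * ((\<Sum>i<n. \<Sum>l<n. (lattice_eta_sum n i l / (real n - 1)) ^ card u) / (real n)\<^sup>2))"
proof -
  let ?Z = "PiE {1..d} (\<lambda>_. {1..n - 1})"
  let ?U = "{u. u \<noteq> {} \<and> u \<subseteq> {1..d}}"
  let ?e = "\<lambda>i l z. eta (frac (real i * real z / real n)) (frac (real l * real z / real n))"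
  have U: "Pow {1..d} = insert {} ?U" "finite ?U" "{} \<notin> ?U" by (auto intro: finite_subset[of _ "Pow {1..d}"])
  have kernel: "sobolev_kernel d \<gamma> (lattice_point d n z i) (lattice_point d n z l)
      = \<gamma> {} + (\<Sum>u\<in>?U. \<gamma> u * (\<Prod>j\<in>u. ?e i l (z j)))" for z i l
  proof -
    have "(\<Prod>j\<in>u. eta (lattice_point d n z i j) (lattice_point d n z l j)) = (\<Prod>j\<in>u. ?e i l (z j))"
      if "u \<in> ?U" for u
      using that by (intro prod.cong refl) (auto simp: lattice_point_def)
    then have "(\<Sum>u\<in>?U. \<gamma> u * (\<Prod>j\<in>u. eta (lattice_point d n z i j) (lattice_point d n z l j)))
        = (\<Sum>u\<in>?U. \<gamma> u * (\<Prod>j\<in>u. ?e i l (z j)))"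
      by (intro sum.cong refl) (simp only:)
    then show ?thesis
      unfolding sobolev_kernel_def U(1) sum.insert[OF U(2,3)] by (simp only: prod.empty mult_1_right)
  qed
  have mean: "(\<Sum>z\<in>?Z. \<Prod>j\<in>u. ?e i l (z j)) / (real n - 1) ^ d
      = (lattice_eta_sum n i l / (real n - 1)) ^ card u" if "u \<in> ?U" for u i l
  proof -
    have "{1..n - 1} = {1..<n}" "real (n - 1) = real n - 1" using n by auto
    then show ?thesis
      using sum_PiE_prod_subset[of "{1..d}" u "{1..n - 1}" "\<lambda>_. ?e i l"] that n
      by (simp add: lattice_eta_sum_def)
  qed
  have "(\<Sum>i<n. \<Sum>l<n. sobolev_kernel d \<gamma> (lattice_point d n z i) (lattice_point d n z l)) / (real n)\<^sup>2
      - \<gamma> {} = (\<Sum>u\<in>?U. \<Sum>i<n. \<Sum>l<n. \<gamma> u * (\<Prod>j\<in>u. ?e i l (z j))) / (real n)\<^sup>2" for z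
  proof -
    have "(\<Sum>i<n. \<Sum>l<n. sobolev_kernel d \<gamma> (lattice_point d n z i) (lattice_point d n z l))
        = (real n)\<^sup>2 * \<gamma> {} + (\<Sum>i<n. \<Sum>l<n. \<Sum>u\<in>?U. \<gamma> u * (\<Prod>j\<in>u. ?e i l (z j)))"
      unfolding kernel by (simp add: sum.distrib power2_eq_square)
    also have "(\<Sum>i<n. \<Sum>l<n. \<Sum>u\<in>?U. \<gamma> u * (\<Prod>j\<in>u. ?e i l (z j)))
        = (\<Sum>u\<in>?U. \<Sum>i<n. \<Sum>l<n. \<gamma> u * (\<Prod>j\<in>u. ?e i l (z j)))"
      by (rule sum_rotate[symmetric])
    finally show ?thesis using n by (simp add: add_divide_distrib)
  qed
  then have "(\<Sum>z\<in>?Z. (\<Sum>i<n. \<Sum>l<n. sobolev_kernel d \<gamma> (lattice_point d n z i) (lattice_point d n z l)) / (real n)\<^sup>2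
      - \<gamma> {}) / (real n - 1) ^ d
      = (\<Sum>z\<in>?Z. \<Sum>u\<in>?U. \<Sum>i<n. \<Sum>l<n. \<gamma> u * (\<Prod>j\<in>u. ?e i l (z j))) / (real n)\<^sup>2 / (real n - 1) ^ d"
    by (simp only: sum_divide_distrib)
  also have "(\<Sum>z\<in>?Z. \<Sum>u\<in>?U. \<Sum>i<n. \<Sum>l<n. \<gamma> u * (\<Prod>j\<in>u. ?e i l (z j)))
      = (\<Sum>u\<in>?U. \<Sum>z\<in>?Z. \<Sum>i<n. \<Sum>l<n. \<gamma> u * (\<Prod>j\<in>u. ?e i l (z j)))"
    by (rule sum.swap)
  also have "\<dots> = (\<Sum>u\<in>?U. \<Sum>i<n. \<Sum>l<n. \<Sum>z\<in>?Z. \<gamma> u * (\<Prod>j\<in>u. ?e i l (z j)))"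
    by (intro sum.cong refl sum_rotate)
  also have "\<dots> / (real n)\<^sup>2 / (real n - 1) ^ d
      = (\<Sum>u\<in>?U. \<gamma> u * ((\<Sum>i<n. \<Sum>l<n. (\<Sum>z\<in>?Z. \<Prod>j\<in>u. ?e i l (z j)) / (real n - 1) ^ d) / (real n)\<^sup>2))"
    by (simp add: sum_distrib_left sum_divide_distrib mult_ac)
  also have "\<dots> = (\<Sum>u\<in>?U. \<gamma> u * ((\<Sum>i<n. \<Sum>l<n. (lattice_eta_sum n i l / (real n - 1)) ^ card u) / (real n)\<^sup>2))"
    by (intro sum.cong refl) (simp only: mean)
  finally show ?thesis .
qed

theorem theorem2:
  fixes d n :: nat
    and \<gamma> :: "nat set \<Rightarrow> real"
    and H :: "((nat \<Rightarrow> real) \<Rightarrow> real) set"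
    and ip :: "((nat \<Rightarrow> real) \<Rightarrow> real) \<Rightarrow> ((nat \<Rightarrow> real) \<Rightarrow> real) \<Rightarrow> real"
  assumes "d \<ge> 1"
    and "\<And>u. \<gamma> u \<ge> 0"
    and "prime n" and "odd n"
    and "rkhs (unit_cube d) (sobolev_kernel d \<gamma>) H ip"
  shows "mean_squared_worst_case_error H ip d n
    \<le> ln (real n) / sqrt (real n) * (\<Sum>u | u \<noteq> {} \<and> u \<subseteq> {1..d}. \<gamma> u * C_const u)"
proof -
  have n: "n \<ge> 2" using assms(3) by (rule prime_ge_2_nat)
  let ?U = "{u. u \<noteq> {} \<and> u \<subseteq> {1..d}}"
  have "mean_squared_worst_case_error H ip d n
      \<le> (\<Sum>z\<in>PiE {1..d} (\<lambda>_. {1..n - 1}).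
      (\<Sum>i<n. \<Sum>l<n. sobolev_kernel d \<gamma> (lattice_point d n z i) (lattice_point d n z l)) / (real n)\<^sup>2
      - \<gamma> {}) / (real n - 1) ^ d"
    unfolding mean_squared_worst_case_error_def
    using n by (intro divide_right_mono sum_mono worst_case_error_squared_le assms) auto
  also have "\<dots> = (\<Sum>u\<in>?U.
        \<gamma> u * ((\<Sum>i<n. \<Sum>l<n. (lattice_eta_sum n i l / (real n - 1)) ^ card u) / (real n)\<^sup>2))"
    by (rule mean_kernel_excess_eq[OF n])
  also have "\<dots> \<le> (\<Sum>u\<in>?U. \<gamma> u * (ln (real n) / sqrt (real n) * C_const u))"
    using assms finite_subset
    by (intro sum_mono mult_left_mono lattice_eta_power_mean_le) auto
  also have "\<dots> = ln (real n) / sqrt (real n) * (\<Sum>u\<in>?U. \<gamma> u * C_const u)"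
    by (simp add: sum_distrib_left mult_ac)
  finally show ?thesis .
qed

end
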